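(* Fix $C<\infty$. Let $m=m_n$ be a sequence of positive integers such that $1\leq m_n\leq Cn^3$. Let $D_{m,n}$ be the number of acyclic orientations of the complete $n$-partite graph with all parts of size $m$. Then, as $n\to\infty$, $$D_{m,n}=(mn)!\,\exp\!\left(-\frac m2+\frac12-\frac{5m}{24n}-\frac{m}{8n^2}-\frac{251m}{2880n^3}+O_C(n^{-1})\right).$$ In particular: if $m=O(n)$, the terms $-\frac{m}{8n^2}$ and $-\frac{251m}{2880n^3}$ are absorbed in the $O(n^{-1})$ error; if $m/n^2\to\rho$, the factor $\exp(-m/(8n^2))$ contributes $e^{-\rho/8}$ in the limit; if $m/n^3\to\sigma$, the factor $\exp(-251m/(2880n^3))$ contributes $\exp(-251\sigma/2880)$ in the limit. For the main diagonal $m=n$, $$\mathrm{AO}(K_{\underbrace{n,\ldots,n}_{n}})=(n^2)!\exp\!\left(-\frac n2+\frac7{24}+O(n^{-1})\right).$$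
   Context: $\mathrm{AO}(G)$ is the number of acyclic orientations of $G$; $K_{n,\ldots,n}$ ($n$ indices) is the complete $n$-partite graph with all parts of size $n$. $O_C(n^{-1})$ denotes a quantity bounded in absolute value by $K n^{-1}$ with $K$ depending only on $C$. *)

theory Defs
  imports Complex_Main "HOL-Library.Landau_Symbols"
begin

(* A finite simple graph is given by its edge set, whose members are two-element sets
   of vertices.  Isolated vertices play no role for orientations. *)

definition is_orientation :: "'a set set \<Rightarrow> ('a \<times> 'a) set \<Rightarrow> bool" where
  "is_orientation E R \<longleftrightarrow>
     (\<forall>u v. (u, v) \<in> R \<longrightarrow> {u, v} \<in> E) \<and>
     (\<forall>u v. {u, v} \<in> E \<longrightarrow> ((u, v) \<in> R) \<noteq> ((v, u) \<in> R))"

definition num_acyclic_orientations :: "'a set set \<Rightarrow> nat" where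
  "num_acyclic_orientations E = card {R. is_orientation E R \<and> acyclic R}"

(* The i-th part, for i < n, consists of the vertices (i, j) with j < k i. *)

definition complete_multipartite :: "nat \<Rightarrow> (nat \<Rightarrow> nat) \<Rightarrow> (nat \<times> nat) set set" where
  "complete_multipartite n k =
     {{u, v} | u v. u \<in> Sigma {..<n} (\<lambda>i. {..<k i}) \<and>
                    v \<in> Sigma {..<n} (\<lambda>i. {..<k i}) \<and> fst u \<noteq> fst v}"

(* D_{m,n}: n is the number of parts and m the size of each part. *)

definition D :: "nat \<Rightarrow> nat \<Rightarrow> nat" where
  "D m n = num_acyclic_orientations (complete_multipartite n (\<lambda>_. m))"

end

theory Submission
  imports Defs "HOL-Analysis.Analysis" "HOL-Computational_Algebra.Polynomial"
begin

text \<open>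
  Inclusion-exclusion over sets of sources gives a recursion for the number of acyclic orientations,
  which the integral of \<open>exp (- x) * P x ^ n\<close> over the positive reals satisfies as well. Here \<open>P\<close> is the
  \<open>m\<close>-th Touchard polynomial with alternating signs, determined by \<open>P_(m+1) = x * (P_m - P_m')\<close>. By Rolle's
  theorem \<open>P\<close> has \<open>m\<close> real nonnegative roots, and a barrier argument bounds them by \<open>4 * m\<close>. For \<open>x\<close> of
  size \<open>N = m * n\<close> the logarithm of \<open>P\<close> can therefore be expanded in the power sums of the roots. Relative
  to the mean of the roots the terms of order two to four are, up to negligible errors, constants plus multiples of \<open>ln x\<close>,
  so that the integrand is sandwiched between multiples of a single Gamma density \<open>y powr (N + S) * exp (- y)\<close>.
  The lower bound carries a factor \<open>1 - c * (y / N - 1) ^ 2\<close>, whose mean is given by the first two moments of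
  that density. The ratio \<open>Gamma (N + S + 1) / N powr S\<close> produces
  the factor \<open>exp (S\<^sup>2 / (2 * N))\<close>, which together with the fourth power sum yields the constant \<open>251 / 2880\<close>.
\<close>

section \<open>Acyclic orientations and Touchard polynomials\<close>

text \<open>Linearly bounded roots make every \<open>c i / (x - a)\<close> of order
  \<open>1 / n\<close> when \<open>x\<close> is of size \<open>m * n\<close>. Over \<open>m\<close>
  roots and \<open>n\<close> equal factors a term of order \<open>k\<close> therefore totals
  \<open>m / n ^ (k - 1)\<close>, and under \<open>m \<le> C * n ^ 3\<close> the fifth order is
  \<open>O(1 / n)\<close>. This is why the expansion stops at order four and why cubic growth is its
  range. The obstacle is that for \<open>m\<close> far above \<open>n\<close> the corrections are
  unbounded, so they are no small perturbation of \<open>x ^ N * exp (- x)\<close>. Absorbing their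
  tangents in \<open>ln x\<close> into the exponent of the Gamma density moves its centre along with
  them. What remains is quadratic in the relative deviation from \<open>N\<close>, and its mean has
  size \<open>m / n\<close> times \<open>1 / N + (S / N) ^ 2\<close>, that is
  \<open>1 / n ^ 2 + m / n ^ 5\<close>. Since the comparison density is integrated exactly, the
  factorial appears by itself, without Stirling's formula.\<close>

lemma sum_Pow_insert:
  fixes f :: "'a set \<Rightarrow> 'b::comm_monoid_add"
  assumes "finite A" "a \<notin> A"
  shows "(\<Sum>S\<in>Pow (insert a A). f S) = (\<Sum>S\<in>Pow A. f S + f (insert a S))"
proof -
  have inj: "inj_on (insert a) (Pow A)"
    using assms by (intro inj_onI) (metis PowD insert_ident subsetD)
  have "(\<Sum>S\<in>Pow (insert a A). f S) = (\<Sum>S\<in>Pow A. f S) + (\<Sum>S\<in>insert a ` Pow A. f S)"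
    unfolding Pow_insert using assms by (intro sum.union_disjoint) auto
  then show ?thesis
    by (simp add: sum.reindex[OF inj] sum.distrib)
qed

lemma sum_Pow_sign_eq_0:
  assumes "finite A" "A \<noteq> {}"
  shows "(\<Sum>S\<in>Pow A. (- 1) ^ card S) = (0::real)"
proof -
  obtain a B where A: "A = insert a B" "a \<notin> B" using assms by (metis all_not_in_conv mk_disjoint_insert)
  with assms have fin: "finite B" by simp
  have "(- 1) ^ card S + (- 1) ^ card (insert a S) = (0::real)" if "S \<in> Pow B" for S
    using that A fin by (subst card_insert_disjoint) (auto intro: finite_subset)
  then show ?thesis
    unfolding A(1) sum_Pow_insert[OF fin A(2)] by (simp add: sum.neutral)
qed

text \<open>This is \<open>(- 1) ^ m * T (- x)\<close> for the \<open>m\<close>-th Touchard polynomial \<open>T\<close>, that is,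
  \<open>\<Sum>k. (- 1) ^ (m - k) * Stirling m k * x ^ k\<close>.\<close>

fun touchard_poly :: "nat \<Rightarrow> real poly" where
  "touchard_poly 0 = 1"
| "touchard_poly (Suc k) = [:0, 1:] * (touchard_poly k - pderiv (touchard_poly k))"

lemma pderiv_sum: "pderiv (\<Sum>x\<in>A. f x) = (\<Sum>x\<in>A. pderiv (f x))"
  by (induction A rule: infinite_finite_induct) (auto simp: pderiv_add)

text \<open>Splitting off one point turns the sum \<open>B\<close> into
  \<open>x * (B - B') - B\<close>. The right-hand side \<open>q = P - P'\<close> obeys the same
  rule, because the next polynomial is \<open>x * q\<close> and
  \<open>x * q - (x * q)' = x * (q - q') - q\<close>. Hence the nonempty \<open>S\<close> alone
  contribute \<open>- P'\<close>.\<close>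

lemma sum_Pow_touchard_poly:
  assumes "finite A"
  shows "(\<Sum>S\<in>Pow A. smult ((- 1) ^ card S) (touchard_poly (card (A - S)))) =
           touchard_poly (card A) - pderiv (touchard_poly (card A))"
  using assms
proof (induction A rule: finite_induct)
  case empty
  show ?case by simp
next
  case (insert a A)
  let ?B = "\<Sum>S\<in>Pow A. smult ((- 1) ^ card S) (touchard_poly (card (A - S)))"
  have "(\<Sum>S\<in>Pow (insert a A). smult ((- 1) ^ card S) (touchard_poly (card (insert a A - S)))) =
        (\<Sum>S\<in>Pow A. smult ((- 1) ^ card S) (touchard_poly (Suc (card (A - S)))) -
                     smult ((- 1) ^ card S) (touchard_poly (card (A - S))))"
    unfolding sum_Pow_insert[OF insert.hyps]
  proof (intro sum.cong refl)
    fix S assume "S \<in> Pow A"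
    then have S: "S \<subseteq> A" "finite S" "a \<notin> S" using insert.hyps finite_subset by auto
    have "card (insert a A - S) = Suc (card (A - S))"
      using S insert.hyps by (simp add: insert_Diff_if)
    moreover have "insert a A - insert a S = A - S" using S insert.hyps by auto
    ultimately show "smult ((- 1) ^ card S) (touchard_poly (card (insert a A - S))) +
        smult ((- 1) ^ card (insert a S)) (touchard_poly (card (insert a A - insert a S))) =
        smult ((- 1) ^ card S) (touchard_poly (Suc (card (A - S)))) -
        smult ((- 1) ^ card S) (touchard_poly (card (A - S)))"
      using S by simp
  qed
  also have "\<dots> = [:0, 1:] * (?B - pderiv ?B) - ?B"
    by (simp add: sum_subtractf pderiv_sum pderiv_smult sum_distrib_left smult_diff_right
                  right_diff_distrib del: mult_pCons_left)
  also have "\<dots> = touchard_poly (card (insert a A)) - pderiv (touchard_poly (card (insert a A)))"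
    unfolding insert.IH using insert.hyps
    by (simp add: pderiv_mult pderiv_diff pderiv_pCons algebra_simps)
  finally show ?case .
qed

text \<open>This is the integral of \<open>exp (- x) * poly p x\<close> over
  \<open>x \<ge> 0\<close>, with each \<open>x ^ i\<close> evaluated to \<open>i!\<close>. The
  combinatorial part thus stays free of integration.\<close>

definition poly_laplace :: "real poly \<Rightarrow> real" where
  "poly_laplace p = (\<Sum>i\<le>degree p. coeff p i * fact i)"

lemma poly_laplace_eq:
  assumes "degree p \<le> n"
  shows "poly_laplace p = (\<Sum>i\<le>n. coeff p i * fact i)"
  unfolding poly_laplace_def using assms
  by (intro sum.mono_neutral_left) (auto simp: coeff_eq_0)

lemma poly_laplace_add: "poly_laplace (p + q) = poly_laplace p + poly_laplace q"
proof -
  define n where "n = max (degree p) (degree q)"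
  have "degree (p + q) \<le> n" "degree p \<le> n" "degree q \<le> n"
    by (auto simp: n_def degree_add_le_max)
  then show ?thesis
    by (simp add: poly_laplace_eq[where n = n] distrib_right sum.distrib)
qed

lemma poly_laplace_smult: "poly_laplace (smult c p) = c * poly_laplace p"
  using poly_laplace_eq[of "smult c p" "degree p"]
  by (simp add: poly_laplace_def degree_smult_le sum_distrib_left mult.assoc)

lemma poly_laplace_0 [simp]: "poly_laplace 0 = 0"
  by (simp add: poly_laplace_def)

lemma poly_laplace_sum: "poly_laplace (\<Sum>x\<in>A. f x) = (\<Sum>x\<in>A. poly_laplace (f x))"
  by (induction A rule: infinite_finite_induct) (auto simp: poly_laplace_add)

text \<open>Integration by parts, with boundary term \<open>p(0)\<close>; on coefficients it is an
  index shift.\<close>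

lemma poly_laplace_pderiv: "poly_laplace (pderiv p) = poly_laplace p - coeff p 0"
proof -
  have "poly_laplace p = (\<Sum>i\<le>Suc (degree p). coeff p i * fact i)"
    by (rule poly_laplace_eq) simp
  also have "\<dots> = coeff p 0 + (\<Sum>i\<le>degree p. coeff p (Suc i) * fact (Suc i))"
    by (subst sum.atMost_Suc_shift) simp
  also have "(\<Sum>i\<le>degree p. coeff p (Suc i) * fact (Suc i)) = poly_laplace (pderiv p)"
    by (subst poly_laplace_eq[where n = "degree p"]) (auto simp: degree_pderiv coeff_pderiv algebra_simps intro!: sum.cong)
  finally show ?thesis by simp
qed

section \<open>Sources and the recursion for acyclic orientations\<close>

definition acyclic_orientations :: "'a set set \<Rightarrow> ('a \<times> 'a) set set" where
  "acyclic_orientations E = {R. is_orientation E R \<and> acyclic R}"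

text \<open>Excluding the empty set makes every term of the recursion refer to a graph with fewer
  vertices.\<close>

definition independent_sets :: "'a set \<Rightarrow> 'a set set \<Rightarrow> 'a set set" where
  "independent_sets V E = {S. S \<subseteq> V \<and> S \<noteq> {} \<and> (\<forall>e\<in>E. \<not> e \<subseteq> S)}"

locale finite_graph =
  fixes V :: "'a set" and E :: "'a set set"
  assumes finite_V: "finite V"
    and edges: "\<And>e. e \<in> E \<Longrightarrow> \<exists>u\<in>V. \<exists>v\<in>V. u \<noteq> v \<and> e = {u, v}"
begin

lemma edge_in: "{u, v} \<in> E \<Longrightarrow> u \<in> V \<and> v \<in> V \<and> u \<noteq> v"
  using edges[of "{u, v}"] by (auto simp: doubleton_eq_iff)

lemma orientation_subset: "is_orientation E R \<Longrightarrow> R \<subseteq> V \<times> V"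
  using edge_in by (auto simp: is_orientation_def)

lemma finite_acyclic_orientations: "finite (acyclic_orientations E)"
  by (rule finite_subset[of _ "Pow (V \<times> V)"])
     (use finite_V orientation_subset in \<open>auto simp: acyclic_orientations_def\<close>)

definition sources :: "('a \<times> 'a) set \<Rightarrow> 'a set" where
  "sources R = {v \<in> V. \<forall>u. (u, v) \<notin> R}"

lemma sources_nonempty:
  assumes "R \<in> acyclic_orientations E" "V \<noteq> {}"
  shows "sources R \<noteq> {}"
proof -
  have R: "R \<subseteq> V \<times> V" "acyclic R"
    using assms orientation_subset by (auto simp: acyclic_orientations_def)
  then have "wf R" using finite_V by (meson finite_acyclic_wf finite_SigmaI finite_subset)
  then obtain z where "z \<in> V" "\<And>y. (y, z) \<in> R \<Longrightarrow> y \<notin> V"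
    using assms(2) by (metis all_not_in_conv wf_eq_minimal)
  then show ?thesis using R by (auto simp: sources_def)
qed

text \<open>If all of \<open>S\<close> are sources, the edges at \<open>S\<close> are forced to
  point away from it. Deleting them and restoring them are inverse operations, and restoring them
  creates no cycle because nothing enters \<open>S\<close>.\<close>

lemma card_orientations_with_sources:
  assumes S: "S \<in> independent_sets V E"
  shows "card {R \<in> acyclic_orientations E. S \<subseteq> sources R} =
         card (acyclic_orientations {e \<in> E. e \<inter> S = {}})"
proof (rule bij_betw_same_card)
  let ?f = "\<lambda>R. {(u, v) \<in> R. u \<notin> S}"
  let ?g = "\<lambda>R. R \<union> {(u, v). u \<in> S \<and> {u, v} \<in> E}"
  let ?A = "{R \<in> acyclic_orientations E. S \<subseteq> sources R}"
  let ?B = "acyclic_orientations {e \<in> E. e \<inter> S = {}}"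
  have ind: "v \<notin> S" if "u \<in> S" "{u, v} \<in> E" for u v
    using that S by (fastforce simp: independent_sets_def)
  have SV: "S \<subseteq> V" using S by (auto simp: independent_sets_def)
  show "bij_betw ?f ?A ?B"
  proof (rule bij_betw_byWitness[where f' = ?g])
    show "\<forall>R\<in>?A. ?g (?f R) = R"
    proof
      fix R assume "R \<in> ?A"
      then have o: "is_orientation E R" and s: "\<And>u v. v \<in> S \<Longrightarrow> (u, v) \<notin> R"
        by (auto simp: acyclic_orientations_def sources_def)
      have "(u, v) \<in> R" if "u \<in> S" "{u, v} \<in> E" for u v
        using o s[OF that(1), of v] that unfolding is_orientation_def by blast
      moreover have "{u, v} \<in> E" if "(u, v) \<in> R" for u v
        using o that unfolding is_orientation_def by blast
      ultimately show "?g (?f R) = R" by blast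
    qed
    show "\<forall>R\<in>?B. ?f (?g R) = R"
    proof
      fix R assume "R \<in> ?B"
      then have "is_orientation {e \<in> E. e \<inter> S = {}} R" by (simp add: acyclic_orientations_def)
      then have "u \<notin> S" if "(u, v) \<in> R" for u v using that unfolding is_orientation_def by blast
      then show "?f (?g R) = R" by blast
    qed
    show "?f ` ?A \<subseteq> ?B"
    proof
      fix T assume "T \<in> ?f ` ?A"
      then obtain R where R: "R \<in> ?A" "T = ?f R" by blast
      then have o: "is_orientation E R" and s: "\<And>u v. v \<in> S \<Longrightarrow> (u, v) \<notin> R" and a: "acyclic R"
        by (auto simp: acyclic_orientations_def sources_def)
      have "acyclic T" using a acyclic_subset[OF a, of T] R by auto
      moreover have "is_orientation {e \<in> E. e \<inter> S = {}} T"
        unfolding is_orientation_def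
      proof (intro conjI allI impI)
        fix u v assume "(u, v) \<in> T"
        then have uv: "(u, v) \<in> R" "u \<notin> S" using R by auto
        then have "v \<notin> S" using s by blast
        then show "{u, v} \<in> {e \<in> E. e \<inter> S = {}}" using uv o unfolding is_orientation_def by auto
      next
        fix u v assume "{u, v} \<in> {e \<in> E. e \<inter> S = {}}"
        then have "{u, v} \<in> E" "u \<notin> S" "v \<notin> S" by auto
        then show "((u, v) \<in> T) \<noteq> ((v, u) \<in> T)" using o R unfolding is_orientation_def by auto
      qed
      ultimately show "T \<in> ?B" by (simp add: acyclic_orientations_def)
    qed
    show "?g ` ?B \<subseteq> ?A"
    proof
      fix T assume "T \<in> ?g ` ?B"
      then obtain R where R: "R \<in> ?B" "T = ?g R" by blast
      then have o: "is_orientation {e \<in> E. e \<inter> S = {}} R" and a: "acyclic R"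
        by (auto simp: acyclic_orientations_def)
      have RS: "u \<notin> S \<and> v \<notin> S \<and> {u, v} \<in> E" if "(u, v) \<in> R" for u v
        using o that unfolding is_orientation_def by blast
      have T: "v \<notin> S \<and> (u \<notin> S \<longrightarrow> (u, v) \<in> R)" if "(u, v) \<in> T" for u v
        using that R RS ind by blast
      \<comment> \<open>No path ends in \<open>S\<close>, and a path that starts outside
        \<open>S\<close> uses edges of \<open>R\<close> only, so a cycle of \<open>T\<close> would
        already be one of \<open>R\<close>.\<close>
      have "v \<notin> S \<and> (u \<notin> S \<longrightarrow> (u, v) \<in> R\<^sup>+)" if "(u, v) \<in> T\<^sup>+" for u v
        using that
      proof (induction rule: trancl_induct)
        case (base y) then show ?case using T by blast
      next
        case (step y z) then show ?case using T[of y z] by (meson trancl.trancl_into_trancl)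
      qed
      then have "acyclic T" using a unfolding acyclic_def by blast
      moreover have "is_orientation E T"
        unfolding is_orientation_def
      proof (intro conjI allI impI)
        fix u v assume "(u, v) \<in> T" then show "{u, v} \<in> E" using R RS by blast
      next
        fix u v assume uv: "{u, v} \<in> E"
        show "((u, v) \<in> T) \<noteq> ((v, u) \<in> T)"
        proof (cases "u \<in> S \<or> v \<in> S")
          case True
          then show ?thesis using uv ind[of u v] ind[of v u] R RS by (auto simp: insert_commute)
        next
          case False
          then have "{u, v} \<in> {e \<in> E. e \<inter> S = {}}" using uv by auto
          then have "((u, v) \<in> R) \<noteq> ((v, u) \<in> R)" using o unfolding is_orientation_def by blast
          then show ?thesis using False R by auto
        qed
      qed
      moreover have "S \<subseteq> sources T" using T SV by (auto simp: sources_def)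
      ultimately show "T \<in> ?A" by (simp add: acyclic_orientations_def)
    qed
  qed
qed

text \<open>An edge between two sources would have to point into one of them.\<close>

lemma sources_independent:
  assumes "R \<in> acyclic_orientations E" "S \<subseteq> sources R" "S \<noteq> {}"
  shows "S \<in> independent_sets V E"
proof -
  have False if e: "e \<in> E" "e \<subseteq> S" for e
  proof -
    obtain u v where "e = {u, v}" using edges[OF e(1)] by blast
    then show False
      using that assms unfolding acyclic_orientations_def is_orientation_def sources_def by blast
  qed
  then show ?thesis using assms by (auto simp: independent_sets_def sources_def)
qed

text \<open>Every acyclic orientation of a nonempty graph has a nonempty set of sources, so the signs
  \<open>- (- 1) ^ card S\<close> over its nonempty subsets \<open>S\<close> add up to \<open>1\<close>.\<close>

theorem card_acyclic_orientations_recursion: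
  assumes "V \<noteq> {}"
  shows "real (card (acyclic_orientations E)) =
    (\<Sum>S\<in>independent_sets V E.
       - ((- 1) ^ card S * real (card (acyclic_orientations {e \<in> E. e \<inter> S = {}}))))"
proof -
  let ?I = "independent_sets V E" and ?O = "acyclic_orientations E"
  have finI: "finite ?I"
    by (rule finite_subset[of _ "Pow V"]) (use finite_V in \<open>auto simp: independent_sets_def\<close>)
  have one: "(\<Sum>S\<in>?I. if S \<subseteq> sources R then - ((- 1) ^ card S) else 0) = (1::real)" if R: "R \<in> ?O" for R
  proof -
    have fin: "finite (sources R)" using finite_V by (simp add: sources_def)
    have "(\<Sum>S\<in>?I. if S \<subseteq> sources R then - ((- 1) ^ card S) else 0) =
          (\<Sum>S\<in>?I \<inter> {S. S \<subseteq> sources R}. - ((- 1) ^ card S) :: real)"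
      by (rule sum.inter_restrict[OF finI, symmetric, where B = "{S. S \<subseteq> sources R}", simplified])
    also have "?I \<inter> {S. S \<subseteq> sources R} = Pow (sources R) - {{}}"
      using sources_independent[OF R] by (auto simp: independent_sets_def)
    also have "(\<Sum>S\<in>Pow (sources R) - {{}}. - ((- 1) ^ card S) :: real) = 1"
      using sum_Pow_sign_eq_0[OF fin sources_nonempty[OF R assms]] fin
      by (simp add: sum_diff1 sum_negf)
    finally show ?thesis .
  qed
  have "real (card ?O) = (\<Sum>R\<in>?O. \<Sum>S\<in>?I. if S \<subseteq> sources R then - ((- 1) ^ card S) else 0)"
    using one by simp
  also have "\<dots> = (\<Sum>S\<in>?I. \<Sum>R\<in>?O. if S \<subseteq> sources R then - ((- 1) ^ card S) else 0)"
    by (rule sum.swap)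
  also have "\<dots> = (\<Sum>S\<in>?I. - ((- 1) ^ card S * real (card {R \<in> ?O. S \<subseteq> sources R})))"
    using finite_acyclic_orientations
    by (intro sum.cong refl) (simp add: sum.If_cases Int_def)
  finally show ?thesis by (simp add: card_orientations_with_sources)
qed

end

section \<open>Complete multipartite graphs\<close>

definition multipartite_edges :: "(nat \<times> nat) set \<Rightarrow> (nat \<times> nat) set set" where
  "multipartite_edges V = {{u, v} |u v. u \<in> V \<and> v \<in> V \<and> fst u \<noteq> fst v}"

lemma finite_graph_multipartite:
  assumes "finite V"
  shows "finite_graph V (multipartite_edges V)"
proof
  fix e assume "e \<in> multipartite_edges V"
  then obtain u v where "u \<in> V" "v \<in> V" "fst u \<noteq> fst v" "e = {u, v}"
    unfolding multipartite_edges_def by blast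
  then show "\<exists>u\<in>V. \<exists>v\<in>V. u \<noteq> v \<and> e = {u, v}" by metis
qed fact

abbreviation colour_class :: "(nat \<times> nat) set \<Rightarrow> nat \<Rightarrow> (nat \<times> nat) set" where
  "colour_class V i \<equiv> {v \<in> V. fst v = i}"

lemma multipartite_edges_minus:
  "{e \<in> multipartite_edges V. e \<inter> S = {}} = multipartite_edges (V - S)"
proof (intro set_eqI iffI)
  fix e assume "e \<in> {e \<in> multipartite_edges V. e \<inter> S = {}}"
  then obtain u v where "u \<in> V" "v \<in> V" "fst u \<noteq> fst v" "e = {u, v}" "e \<inter> S = {}"
    unfolding multipartite_edges_def by blast
  then have "u \<in> V - S" "v \<in> V - S" by auto
  with \<open>fst u \<noteq> fst v\<close> \<open>e = {u, v}\<close> show "e \<in> multipartite_edges (V - S)"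
    unfolding multipartite_edges_def by blast
next
  fix e assume "e \<in> multipartite_edges (V - S)"
  then obtain u v where "u \<in> V - S" "v \<in> V - S" "fst u \<noteq> fst v" "e = {u, v}"
    unfolding multipartite_edges_def by blast
  then have "e \<in> multipartite_edges V" and "e \<inter> S = {}"
    unfolding multipartite_edges_def by blast+
  then show "e \<in> {e \<in> multipartite_edges V. e \<inter> S = {}}" by simp
qed

lemma independent_sets_multipartite:
  assumes "V \<subseteq> {..<n} \<times> UNIV"
  shows "independent_sets V (multipartite_edges V) = (\<Union>i<n. Pow (colour_class V i) - {{}})"
proof (intro set_eqI iffI)
  fix S assume "S \<in> independent_sets V (multipartite_edges V)"
  then have S: "S \<subseteq> V" "S \<noteq> {}" and ind: "\<And>e. e \<in> multipartite_edges V \<Longrightarrow> \<not> e \<subseteq> S"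
    by (simp_all add: independent_sets_def)
  have same: "fst u = fst v" if "u \<in> S" "v \<in> S" for u v
  proof (rule ccontr)
    assume "fst u \<noteq> fst v"
    then have "{u, v} \<in> multipartite_edges V"
      unfolding multipartite_edges_def using S(1) that by blast
    then show False using ind that by blast
  qed
  from S(2) obtain s where "s \<in> S" by blast
  have "fst s < n" using S(1) \<open>s \<in> S\<close> assms by (auto dest!: subsetD)
  moreover have "S \<in> Pow (colour_class V (fst s)) - {{}}"
    using S(1,2) same[OF _ \<open>s \<in> S\<close>] by auto
  ultimately show "S \<in> (\<Union>i<n. Pow (colour_class V i) - {{}})" by blast
next
  fix S assume "S \<in> (\<Union>i<n. Pow (colour_class V i) - {{}})"
  then obtain i where i: "S \<subseteq> colour_class V i" "S \<noteq> {}" by blast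
  have "\<not> e \<subseteq> S" if e: "e \<in> multipartite_edges V" for e
  proof
    assume "e \<subseteq> S"
    obtain u v where "fst u \<noteq> fst v" "e = {u, v}"
      using e unfolding multipartite_edges_def by blast
    with \<open>e \<subseteq> S\<close> i show False by auto
  qed
  with i show "S \<in> independent_sets V (multipartite_edges V)"
    unfolding independent_sets_def by blast
qed

lemma pderiv_prod_sum:
  "finite I \<Longrightarrow> pderiv (\<Prod>i\<in>I. f i) = (\<Sum>i\<in>I. pderiv (f i) * (\<Prod>j\<in>I - {i}. f j))"
  using pderiv_prod[of f I] by (simp add: mult.commute)

text \<open>By \<open>sum_Pow_touchard_poly\<close> the source recursion at a product \<open>P\<close> of Touchard polynomials has right-hand side
  \<open>poly_laplace (pderiv P)\<close>, which is \<open>poly_laplace P\<close> as soon as \<open>P\<close> vanishes at \<open>0\<close>.\<close>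

theorem card_acyclic_orientations_multipartite:
  assumes "finite V" "V \<subseteq> {..<n} \<times> UNIV"
  shows "real (card (acyclic_orientations (multipartite_edges V))) =
         poly_laplace (\<Prod>i<n. touchard_poly (card (colour_class V i)))"
  using assms
\<comment> \<open>Deleting \<open>S\<close> shrinks a single part, so equal part sizes do not
  survive the recursion; hence the induction runs over arbitrary vertex sets.\<close>
proof (induction "card V" arbitrary: V rule: less_induct)
  case less
  show ?case
  proof (cases "V = {}")
    case True
    have "acyclic_orientations (multipartite_edges {}) = {{}}"
      by (auto simp: acyclic_orientations_def multipartite_edges_def is_orientation_def acyclic_def)
    then show ?thesis using True by (simp add: poly_laplace_def)
  next
    case False
    interpret finite_graph V "multipartite_edges V"
      by (rule finite_graph_multipartite) fact
    let ?T = "\<lambda>i. touchard_poly (card (colour_class V i))"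
    let ?Q = "\<lambda>i. \<Prod>j\<in>{..<n} - {i}. ?T j"
    have fin: "finite (colour_class V i)" for i using less.prems by simp
    have IH: "real (card (acyclic_orientations (multipartite_edges (V - S)))) =
        poly_laplace (touchard_poly (card (colour_class V i - S)) * ?Q i)"
      if i: "i < n" and S: "S \<subseteq> colour_class V i" "S \<noteq> {}" for i S
    proof -
      have "card (V - S) < card V"
        using S less.prems by (intro psubset_card_mono) auto
      then have "real (card (acyclic_orientations (multipartite_edges (V - S)))) =
          poly_laplace (\<Prod>j<n. touchard_poly (card (colour_class (V - S) j)))"
        using less.prems by (intro less.hyps) auto
      also have "(\<Prod>j<n. touchard_poly (card (colour_class (V - S) j))) =
          touchard_poly (card (colour_class (V - S) i)) *
          (\<Prod>j\<in>{..<n} - {i}. touchard_poly (card (colour_class (V - S) j)))"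
        using i by (subst prod.remove[of _ i]) auto
      also have "(\<Prod>j\<in>{..<n} - {i}. touchard_poly (card (colour_class (V - S) j))) = ?Q i"
      proof (intro prod.cong refl)
        fix j assume "j \<in> {..<n} - {i}"
        then have "colour_class (V - S) j = colour_class V j" using S by auto
        then show "touchard_poly (card (colour_class (V - S) j)) = ?T j" by simp
      qed
      also have "colour_class (V - S) i = colour_class V i - S" by auto
      finally show ?thesis .
    qed
    have "real (card (acyclic_orientations (multipartite_edges V))) =
      (\<Sum>S\<in>(\<Union>i<n. Pow (colour_class V i) - {{}}).
        - ((- 1) ^ card S * real (card (acyclic_orientations (multipartite_edges (V - S))))))"
      using card_acyclic_orientations_recursion[OF False] less.prems
      by (simp add: independent_sets_multipartite multipartite_edges_minus)
    also have "\<dots> = (\<Sum>i<n. \<Sum>S\<in>Pow (colour_class V i) - {{}}.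
        - ((- 1) ^ card S * real (card (acyclic_orientations (multipartite_edges (V - S))))))"
      using fin by (intro sum.UNION_disjoint) auto
    also have "\<dots> = (\<Sum>i<n. poly_laplace (pderiv (?T i) * ?Q i))"
    proof (intro sum.cong refl)
      fix i assume "i \<in> {..<n}"
      then have i: "i < n" by simp
      have "(\<Sum>S\<in>Pow (colour_class V i) - {{}}.
          - ((- 1) ^ card S * real (card (acyclic_orientations (multipartite_edges (V - S)))))) =
        (\<Sum>S\<in>Pow (colour_class V i) - {{}}.
          poly_laplace (- smult ((- 1) ^ card S) (touchard_poly (card (colour_class V i - S))) * ?Q i))"
      proof (intro sum.cong refl)
        fix S assume S: "S \<in> Pow (colour_class V i) - {{}}"
        have "- smult ((- 1) ^ card S) (touchard_poly (card (colour_class V i - S))) * ?Q i =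
              smult (- ((- 1) ^ card S)) (touchard_poly (card (colour_class V i - S)) * ?Q i)" by simp
        then show "- ((- 1) ^ card S * real (card (acyclic_orientations (multipartite_edges (V - S))))) =
          poly_laplace (- smult ((- 1) ^ card S) (touchard_poly (card (colour_class V i - S))) * ?Q i)"
          using IH[OF i, of S] S by (simp only: poly_laplace_smult) simp
      qed
      also have "\<dots> = poly_laplace ((\<Sum>S\<in>Pow (colour_class V i) - {{}}.
          - smult ((- 1) ^ card S) (touchard_poly (card (colour_class V i - S)))) * ?Q i)"
        by (simp only: poly_laplace_sum sum_distrib_right)
      also have "(\<Sum>S\<in>Pow (colour_class V i) - {{}}.
          - smult ((- 1) ^ card S) (touchard_poly (card (colour_class V i - S)))) = pderiv (?T i)"
        using sum_Pow_touchard_poly[OF fin[of i]] fin[of i] by (simp add: sum_diff1 sum_negf)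
      finally show "(\<Sum>S\<in>Pow (colour_class V i) - {{}}.
          - ((- 1) ^ card S * real (card (acyclic_orientations (multipartite_edges (V - S)))))) =
          poly_laplace (pderiv (?T i) * ?Q i)" .
    qed
    also have "\<dots> = poly_laplace (pderiv (\<Prod>i<n. ?T i))"
      by (simp add: pderiv_prod_sum poly_laplace_sum)
    also have "\<dots> = poly_laplace (\<Prod>i<n. ?T i)"
    proof -
      \<comment> \<open>The part of an existing vertex has positive size, so its polynomial carries
        the factor \<open>x\<close> and the product vanishes at \<open>0\<close>.\<close>
      obtain v where v: "v \<in> V" using False by blast
      then have "v \<in> colour_class V (fst v)" by simp
      then have "colour_class V (fst v) \<noteq> {}" by blast
      then have "card (colour_class V (fst v)) \<noteq> 0"
        by (subst card_0_eq[OF fin])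
      then have "poly (?T (fst v)) 0 = 0" by (cases "card (colour_class V (fst v))") auto
      moreover have "fst v < n" using v less.prems by auto
      ultimately have "poly (\<Prod>i<n. ?T i) 0 = 0" by (auto simp: poly_prod)
      then show ?thesis by (simp add: poly_laplace_pderiv poly_0_coeff_0)
    qed
    finally show ?thesis .
  qed
qed

lemma complete_multipartite_eq:
  "complete_multipartite n k = multipartite_edges (Sigma {..<n} (\<lambda>i. {..<k i}))"
  by (auto simp: complete_multipartite_def multipartite_edges_def)

lemma D_eq_poly_laplace: "real (D m n) = poly_laplace (touchard_poly m ^ n)"
proof -
  let ?V = "Sigma {..<n} (\<lambda>i. {..<m})"
  have "card (colour_class ?V i) = m" if "i < n" for i
  proof -
    have "colour_class ?V i = {i} \<times> {..<m}" using that by auto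
    then show ?thesis by simp
  qed
  then have "(\<Prod>i<n. touchard_poly (card (colour_class ?V i))) = touchard_poly m ^ n" by simp
  moreover have "real (card (acyclic_orientations (multipartite_edges ?V))) =
         poly_laplace (\<Prod>i<n. touchard_poly (card (colour_class ?V i)))"
    by (rule card_acyclic_orientations_multipartite) auto
  ultimately show ?thesis
    unfolding D_def num_acyclic_orientations_def complete_multipartite_eq
    by (simp add: acyclic_orientations_def)
qed

text \<open>Orienting every edge towards the part of larger index is acyclic. Positivity is what
  allows the error to be defined later as a logarithm.\<close>

lemma D_pos: "D m n > 0"
proof -
  let ?E = "complete_multipartite n (\<lambda>_. m)"
  let ?R = "{(u, v). {u, v} \<in> ?E \<and> fst u < fst v}"
  interpret finite_graph "Sigma {..<n} (\<lambda>i. {..<m})" ?E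
    unfolding complete_multipartite_eq by (rule finite_graph_multipartite) simp
  have "?R \<subseteq> Wellfounded.measure fst" by auto
  then have "acyclic ?R" by (rule wf_acyclic[OF wf_subset[OF wf_measure]])
  moreover have neq: "fst u \<noteq> fst v" if "{u, v} \<in> ?E" for u v
    using that by (auto simp: complete_multipartite_def doubleton_eq_iff)
  have "((u, v) \<in> ?R) \<noteq> ((v, u) \<in> ?R)" if "{u, v} \<in> ?E" for u v
  proof -
    have "{v, u} = {u, v}" by (rule insert_commute)
    then show ?thesis using that neq[OF that] by auto
  qed
  then have "is_orientation ?E ?R"
    unfolding is_orientation_def by simp
  ultimately have "?R \<in> acyclic_orientations ?E" by (simp add: acyclic_orientations_def)
  then have "card (acyclic_orientations ?E) \<noteq> 0"
    by (subst card_0_eq[OF finite_acyclic_orientations]) blast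
  then show ?thesis
    by (simp add: D_def num_acyclic_orientations_def acyclic_orientations_def)
qed

section \<open>Roots of the Touchard polynomials\<close>

lemma touchard_poly_monic:
  "degree (touchard_poly m) = m \<and> lead_coeff (touchard_poly m) = 1"
proof (induction m)
  case (Suc m)
  define p where "p = touchard_poly m"
  define q where "q = p - pderiv p"
  have p: "degree p = m" "coeff p m = 1" using Suc by (auto simp: p_def)
  have "coeff q m = 1"
    using p by (simp add: q_def coeff_pderiv coeff_eq_0)
  moreover have "degree q \<le> m"
    unfolding q_def using p by (intro degree_diff_le) (auto simp: degree_pderiv)
  ultimately have "degree q = m" by (metis le_antisym le_degree zero_neq_one)
  moreover have "q \<noteq> 0" using \<open>coeff q m = 1\<close> by auto
  ultimately show ?case
    using \<open>coeff q m = 1\<close> by (simp add: p_def[symmetric] q_def[symmetric])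
qed simp

lemma degree_touchard_poly [simp]: "degree (touchard_poly m) = m"
  and coeff_touchard_poly_self [simp]: "coeff (touchard_poly m) m = 1"
  using touchard_poly_monic[of m] by auto

lemma degree_prod_linear: "degree (\<Prod>i\<in>A. [:- r i, 1 :: real:]) = card A"
  and lead_coeff_prod_linear: "lead_coeff (\<Prod>i\<in>A. [:- r i, 1 :: real:]) = 1"
proof -
  show "degree (\<Prod>i\<in>A. [:- r i, 1:]) = card A"
    by (cases "finite A") (auto simp: degree_prod_eq_sum_degree)
  show "lead_coeff (\<Prod>i\<in>A. [:- r i, 1:]) = 1"
    by (simp add: lead_coeff_prod)
qed

lemma monic_eq_prod_linear:
  fixes p :: "real poly"
  assumes "degree p = m" "coeff p m = 1" "inj_on r {..<m}" "\<And>i. i < m \<Longrightarrow> poly p (r i) = 0"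
  shows "p = (\<Prod>i<m. [:- r i, 1:])"
proof (rule poly_eqI_degree_lead_coeff[where n = m and A = "r ` {..<m}"])
  show "coeff p m = coeff (\<Prod>i<m. [:- r i, 1:]) m"
    using assms lead_coeff_prod_linear[of r "{..<m}"] by (simp add: degree_prod_linear)
  show "card (r ` {..<m}) \<ge> m" using assms by (simp add: card_image)
qed (use assms in \<open>auto simp: degree_prod_linear poly_prod\<close>)

text \<open>The weight \<open>exp (- x)\<close> makes \<open>p - p'\<close> a derivative up to a
  factor without zeros, which is what Rolle's theorem needs.\<close>

lemma exp_minus_poly_deriv:
  "((\<lambda>x. exp (- x) * poly p x) has_field_derivative
      - exp (- x) * poly (p - pderiv p) x) (at (x :: real))"
  by (auto intro!: derivative_eq_intros simp: algebra_simps)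

lemma root_between:
  fixes p :: "real poly"
  assumes "a < b" "poly p a = 0" "poly p b = 0"
  shows "\<exists>z. a < z \<and> z < b \<and> poly (p - pderiv p) z = 0"
proof -
  have "\<exists>z. a < z \<and> z < b \<and> exp (- b) * poly p b - exp (- a) * poly p a =
          (b - a) * (- exp (- z) * poly (p - pderiv p) z)"
    using assms(1) by (rule MVT2) (rule exp_minus_poly_deriv)
  then show ?thesis using assms by auto
qed

text \<open>Rolle's theorem between the largest root and infinity: \<open>exp (- x) * p x\<close>
  increases somewhere after \<open>a\<close>, which makes \<open>p - p'\<close> negative there,
  while its leading coefficient makes it positive far out.\<close>

lemma root_beyond:
  fixes p :: "real poly"
  assumes "poly p a = 0" "\<And>x. x > a \<Longrightarrow> poly p x > 0" "lead_coeff (p - pderiv p) > 0"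
  shows "\<exists>z > a. poly (p - pderiv p) z = 0"
proof -
  let ?q = "p - pderiv p"
  have "\<exists>z. a < z \<and> z < a + 1 \<and> exp (- (a + 1)) * poly p (a + 1) - exp (- a) * poly p a =
          (a + 1 - a) * (- exp (- z) * poly ?q z)"
    by (rule MVT2[OF less_add_one]) (rule exp_minus_poly_deriv)
  then obtain z where z: "a < z" "exp (- (a + 1)) * poly p (a + 1) = - exp (- z) * poly ?q z"
    using assms(1) by auto
  have "exp (- (a + 1)) * poly p (a + 1) > 0" using assms(2)[of "a + 1"] by simp
  then have neg: "poly ?q z < 0" unfolding z(2) by (simp add: zero_less_mult_iff mult_less_0_iff)
  obtain N where N: "\<And>x. x \<ge> N \<Longrightarrow> poly ?q x \<ge> lead_coeff ?q"
    using poly_pinfty_gt_lc[OF assms(3)] by blast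
  have "poly ?q (max N (z + 1)) > 0" using N[of "max N (z + 1)"] assms(3) by linarith
  then obtain w where "z < w" "poly ?q w = 0"
    using poly_IVT_pos[of z "max N (z + 1)" ?q] neg by (metis less_add_one less_max_iff_disj)
  then show ?thesis using z by (intro exI[of _ w]) auto
qed

theorem touchard_poly_roots:
  "\<exists>r. strict_mono_on {..<m} r \<and> (\<forall>i<m. 0 \<le> r i) \<and>
       touchard_poly m = (\<Prod>i<m. [:- r i, 1:])"
proof -
  \<comment> \<open>The induction carries \<open>r 0 = 0\<close> in place of nonnegativity: the
    roots of \<open>p - p'\<close> lie one in each gap and one beyond the last root, hence are
    positive, and the factor \<open>x\<close> puts a new root \<open>0\<close> in front of
    them.\<close>
  have "\<exists>r. strict_mono_on {..<m} r \<and> (m > 0 \<longrightarrow> r 0 = 0) \<and>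
       touchard_poly m = (\<Prod>i<m. [:- r i, 1:])"
  proof (induction m)
    case 0
    show ?case by (auto intro!: strict_mono_onI)
  next
    case (Suc m)
    then obtain r where r: "strict_mono_on {..<m} r" "m > 0 \<Longrightarrow> r 0 = 0"
      "touchard_poly m = (\<Prod>i<m. [:- r i, 1:])" by blast
    define p where "p = touchard_poly m"
    define q where "q = p - pderiv p"
    have Suc_eq: "touchard_poly (Suc m) = [:0, 1:] * q" by (simp add: q_def p_def)
    have roots: "poly p (r i) = 0" if "i < m" for i
      using that unfolding p_def r(3) by (auto simp: poly_prod)
    have "q \<noteq> 0" using Suc_eq degree_touchard_poly[of "Suc m"] by auto
    then have lc: "lead_coeff q > 0"
      using touchard_poly_monic[of "Suc m"] unfolding Suc_eq lead_coeff_mult by auto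
    have "\<exists>z. poly q z = 0 \<and> r i < z \<and> (Suc i < m \<longrightarrow> z < r (Suc i))" if i: "i < m" for i
    proof (cases "Suc i < m")
      case True
      then have "r i < r (Suc i)" using r(1) by (simp add: strict_mono_on_def)
      from root_between[OF this roots[OF i] roots[OF True]] show ?thesis
        by (auto simp: q_def)
    next
      case False
      have "poly p x > 0" if x: "x > r i" for x
      proof -
        have "r j \<le> r i" if "j < m" for j
          using that i False strict_mono_on_leD[OF r(1), of j i] by simp
        then show ?thesis
          unfolding p_def r(3) poly_prod using x by (intro prod_pos) force
      qed
      from root_beyond[OF roots[OF i] this] lc False show ?thesis by (auto simp: q_def)
    qed
    then obtain s where s': "\<forall>i<m. poly q (s i) = 0 \<and> r i < s i \<and> (Suc i < m \<longrightarrow> s i < r (Suc i))"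
      by metis
    have s: "\<And>i. i < m \<Longrightarrow> poly q (s i) = 0" "\<And>i. i < m \<Longrightarrow> r i < s i"
      "\<And>i. Suc i < m \<Longrightarrow> s i < r (Suc i)" using s' Suc_lessD by blast+
    define t where "t = case_nat 0 s"
    have sm: "strict_mono_on {..<Suc m} t"
    proof (rule strict_mono_onI)
      fix i j assume ij: "i \<in> {..<Suc m}" "j \<in> {..<Suc m}" "i < j"
      then obtain k where k: "j = Suc k" "k < m" by (cases j) auto
      show "t i < t j"
      proof (cases i)
        case 0
        have "r 0 \<le> r k" using k strict_mono_on_leD[OF r(1), of 0 k] by simp
        then show ?thesis using s(2)[of k] r(2) k 0 by (simp add: t_def)
      next
        case (Suc i')
        then have "s i' < r (Suc i')" "r (Suc i') \<le> r k" "r k < s k"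
          using ij k s strict_mono_on_leD[OF r(1), of "Suc i'" k] by auto
        then show ?thesis using k Suc by (simp add: t_def)
      qed
    qed
    have "touchard_poly (Suc m) = (\<Prod>i<Suc m. [:- t i, 1:])"
    proof (rule monic_eq_prod_linear)
      show "inj_on t {..<Suc m}" using sm by (rule strict_mono_on_imp_inj_on)
      show "poly (touchard_poly (Suc m)) (t i) = 0" if "i < Suc m" for i
        using that s(1) unfolding Suc_eq by (cases i) (auto simp: t_def)
    qed (simp_all only: degree_touchard_poly coeff_touchard_poly_self)
    then show ?case using sm by (intro exI[of _ t]) (simp add: t_def)
  qed
  then obtain r where r: "strict_mono_on {..<m} r" "m > 0 \<Longrightarrow> r 0 = 0"
      "touchard_poly m = (\<Prod>i<m. [:- r i, 1:])" by blast
  have "0 \<le> r i" if "i < m" for i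
    using that strict_mono_on_leD[OF r(1), of 0 i] r(2) by simp
  then show ?thesis using r by blast
qed

section \<open>Linear upper bound for the roots\<close>

lemma poly_pderiv_prod_linear:
  fixes r :: "nat \<Rightarrow> real"
  assumes "\<And>i. i < m \<Longrightarrow> x \<noteq> r i"
  defines "p \<equiv> \<Prod>i<m. [:- r i, 1:]" and "h \<equiv> \<Sum>i<m. 1 / (x - r i)"
  shows "poly (pderiv p) x = poly p x * h"
    and "poly (pderiv (pderiv p)) x = poly p x * (h ^ 2 - (\<Sum>i<m. 1 / (x - r i) ^ 2))"
proof -
  \<comment> \<open>With \<open>h = p' / p\<close> the second identity is
    \<open>p'' / p = h ^ 2 + h'\<close>; it is checked by adjoining one factor at a time.\<close>
  have "poly (pderiv (\<Prod>i<k. [:- r i, 1:])) x = poly (\<Prod>i<k. [:- r i, 1:]) x * (\<Sum>i<k. 1 / (x - r i)) \<and>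
        poly (pderiv (pderiv (\<Prod>i<k. [:- r i, 1:]))) x = poly (\<Prod>i<k. [:- r i, 1:]) x *
          ((\<Sum>i<k. 1 / (x - r i)) ^ 2 - (\<Sum>i<k. 1 / (x - r i) ^ 2))" if "k \<le> m" for k
    using that
  proof (induction k)
    case (Suc k)
    define q where "q = (\<Prod>i<k. [:- r i, 1:])"
    define d where "d = x - r k"
    define a where "a = (\<Sum>i<k. 1 / (x - r i))"
    define b where "b = (\<Sum>i<k. 1 / (x - r i) ^ 2)"
    have d: "d \<noteq> 0" using assms(1)[of k] Suc by (simp add: d_def)
    have IH: "poly (pderiv q) x = poly q x * a" "poly (pderiv (pderiv q)) x = poly q x * (a ^ 2 - b)"
      using Suc by (auto simp: q_def a_def b_def)
    have l: "poly [:- r k, 1:] x = d" by (simp add: d_def)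
    have q': "pderiv (q * [:- r k, 1:]) = pderiv q * [:- r k, 1:] + q"
      by (simp add: pderiv_mult pderiv_pCons del: mult_pCons_right mult_pCons_left)
    have q'': "pderiv (pderiv (q * [:- r k, 1:])) = pderiv (pderiv q) * [:- r k, 1:] + 2 * pderiv q"
      by (simp add: q' pderiv_add pderiv_mult pderiv_pCons del: mult_pCons_right mult_pCons_left)
    have "(\<Prod>i<Suc k. [:- r i, 1:]) = q * [:- r k, 1:]" by (simp add: q_def)
    moreover have "poly (pderiv (q * [:- r k, 1:])) x = poly (q * [:- r k, 1:]) x * (a + 1 / d)"
      using d by (simp add: q' l IH field_simps del: mult_pCons_right poly_pCons)
    moreover have "poly (pderiv (pderiv (q * [:- r k, 1:]))) x =
        poly (q * [:- r k, 1:]) x * ((a + 1 / d) ^ 2 - (b + 1 / d ^ 2))"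
      using d by (simp add: q'' l IH field_simps power2_eq_square del: mult_pCons_right poly_pCons)
    ultimately show ?case by (simp add: a_def b_def d_def)
  qed simp
  from this[of m] show "poly (pderiv p) x = poly p x * h"
    and "poly (pderiv (pderiv p)) x = poly p x * (h ^ 2 - (\<Sum>i<m. 1 / (x - r i) ^ 2))"
    by (auto simp: p_def h_def)
qed

text \<open>The barrier argument: passing from \<open>p\<close> to \<open>x * (p - pderiv p)\<close> and moving the point \<open>b\<close> at which the
  logarithmic derivative is measured by \<open>2\<close> increases it by at most \<open>1 / b\<close>, as long as it is at most \<open>1 / 2\<close>.\<close>

lemma touchard_poly_barrier:
  assumes "k \<le> M" "M > 0"
  shows "(\<forall>x \<ge> 2 * real M + 2 * real k. poly (touchard_poly k) x > 0) \<and>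
         poly (pderiv (touchard_poly k)) (2 * real M + 2 * real k) \<le>
           real k / (2 * real M) * poly (touchard_poly k) (2 * real M + 2 * real k)"
  using assms(1)
proof (induction k)
  case (Suc k)
  define b where "b = 2 * real M + 2 * real k"
  define p where "p = touchard_poly k"
  obtain r where r: "p = (\<Prod>i<k. [:- r i, 1:])"
    using touchard_poly_roots[of k] by (auto simp: p_def)
  have pos: "poly p x > 0" if "x \<ge> b" for x
    using Suc that by (auto simp: p_def b_def)
  have rb: "r i < b" if "i < k" for i
  proof (rule ccontr)
    assume "\<not> r i < b"
    then have "poly p (r i) > 0" by (intro pos) simp
    moreover have "poly p (r i) = 0" using that by (auto simp: r poly_prod)
    ultimately show False by simp
  qed
  define h where "h = (\<lambda>x. \<Sum>i<k. 1 / (x - r i))"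
  define g where "g = (\<lambda>x. \<Sum>i<k. 1 / (x - r i) ^ 2)"
  have ne: "x \<noteq> r i" if "x \<ge> b" "i < k" for x i using rb[OF that(2)] that by simp
  have p': "poly (pderiv p) x = poly p x * h x"
    and p'': "poly (pderiv (pderiv p)) x = poly p x * (h x ^ 2 - g x)" if "x \<ge> b" for x
    using poly_pderiv_prod_linear[of k x r] ne[OF that] by (auto simp: r h_def g_def)
  have hb: "h b \<le> real k / (2 * real M)"
  proof -
    have "h b * poly p b \<le> real k / (2 * real M) * poly p b"
      using Suc p'[of b] by (simp add: p_def b_def mult.commute)
    then show ?thesis by (rule mult_right_le_imp_le) (use pos[of b] in simp)
  qed
  have "real k / (2 * real M) \<le> 1 / 2" using Suc.prems assms(2) by (simp add: field_simps)
  with hb have hb2: "h b \<le> 1 / 2" by simp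
  have hmono: "h x \<le> h b" if "x \<ge> b" for x
    unfolding h_def using that rb by (intro sum_mono frac_le) (auto simp: less_imp_le)
  have bpos: "b > 0" using assms(2) by (simp add: b_def)
  have step: "poly (touchard_poly (Suc k)) x = x * (poly p x * (1 - h x))" if "x \<ge> b" for x
    using p'[OF that] by (simp add: p_def[symmetric] algebra_simps)
  define c where "c = b + 2"
  have cb: "c \<ge> b" by (simp add: c_def)
  \<comment> \<open>Since \<open>- g\<close> is the derivative of the convex function
    \<open>h\<close>, a step of length \<open>2\<close> to the left raises \<open>h\<close> by at
    least \<open>2 * g c\<close>.\<close>
  have convex: "2 * g c \<le> h b - h c"
  proof -
    have "2 * (1 / (c - r i) ^ 2) \<le> 1 / (b - r i) - 1 / (c - r i)" if "i < k" for i
    proof -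
      define d where "d = b - r i"
      have d: "d > 0" using rb[OF that] by (simp add: d_def)
      then have "1 / d - 1 / (d + 2) - 2 * (1 / (d + 2) ^ 2) = 4 / (d * (d + 2) ^ 2)"
        by (simp add: divide_simps power2_eq_square)
      also have "\<dots> \<ge> 0" using d by simp
      finally show ?thesis by (simp add: d_def c_def algebra_simps)
    qed
    then show ?thesis
      unfolding g_def h_def sum_distrib_left sum_subtractf[symmetric] by (intro sum_mono) auto
  qed
  have hc: "h c \<le> 1 / 2" using hmono[OF cb] hb2 by simp
  have g0: "g c \<ge> 0" by (simp add: g_def sum_nonneg)
  have "poly (touchard_poly (Suc k)) x > 0" if "x \<ge> b" for x
    unfolding step[OF that] using bpos that pos[OF that] hmono[OF that] hb2 by simp
  moreover have "poly (pderiv (touchard_poly (Suc k))) c \<le>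
      real (Suc k) / (2 * real M) * poly (touchard_poly (Suc k)) c"
  proof -
    define P where "P = poly p c"
    have P: "P > 0" using pos[OF cb] by (simp add: P_def)
    \<comment> \<open>Dividing by \<open>c * P * (1 - h c)\<close> gives the new logarithmic
      derivative \<open>1 / c + (h c - h c ^ 2 + g c) / (1 - h c)\<close>. The fraction is at most
      \<open>h b\<close> by convexity and \<open>h c \<le> 1 / 2\<close>, and \<open>1 / c\<close>
      is at most the allowed increment \<open>1 / (2 * M)\<close>.\<close>
    have "poly (pderiv (touchard_poly (Suc k))) c =
        P * (1 - h c) + c * (P * (h c - h c ^ 2 + g c))"
      by (simp add: p_def[symmetric] pderiv_mult pderiv_diff pderiv_pCons)
         (simp add: p'[OF cb] p''[OF cb] P_def algebra_simps)
    moreover have "c * (P * (h c - h c ^ 2 + g c)) \<le> c * (P * (real k / (2 * real M) * (1 - h c)))"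
    proof (intro mult_left_mono)
      have "g c \<le> (h b - h c) * (1 - h c)"
      proof -
        have "g c \<le> (h b - h c) * (1 / 2)" using convex by simp
        also have "\<dots> \<le> (h b - h c) * (1 - h c)"
          using hc convex g0 by (intro mult_left_mono) auto
        finally show ?thesis .
      qed
      then have "h c - h c ^ 2 + g c \<le> h b * (1 - h c)"
        by (simp add: algebra_simps power2_eq_square)
      also have "\<dots> \<le> real k / (2 * real M) * (1 - h c)"
        using hb hc by (intro mult_right_mono) auto
      finally show "h c - h c ^ 2 + g c \<le> real k / (2 * real M) * (1 - h c)" .
    qed (use P bpos cb in auto)
    moreover have "P * (1 - h c) \<le> c / (2 * real M) * (P * (1 - h c))"
    proof -
      have "1 \<le> c / (2 * real M)" using assms(2) by (simp add: c_def b_def)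
      then show ?thesis
        using P hc mult_right_mono[of 1 "c / (2 * real M)" "P * (1 - h c)"] by simp
    qed
    ultimately show ?thesis
      unfolding step[OF cb] P_def[symmetric] 
      by (simp add: add_divide_distrib diff_divide_distrib algebra_simps del: touchard_poly.simps)
  qed
  ultimately show ?case
    using cb by (auto simp: b_def c_def algebra_simps)
qed simp

text \<open>The barrier with \<open>M = k = m\<close> sits at \<open>4 * m\<close>. Nonnegativity of
  the roots together with their sum \<open>m * (m - 1) / 2\<close> would only bound them
  quadratically in \<open>m\<close>, which is too weak for quotients of order
  \<open>1 / n\<close>.\<close>

theorem touchard_poly_roots_bounded:
  "\<exists>r. (\<forall>i<m. 0 \<le> r i \<and> r i \<le> 4 * real m) \<and> touchard_poly m = (\<Prod>i<m. [:- r i, 1:])"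
proof -
  obtain r where r: "\<forall>i<m. 0 \<le> r i" "touchard_poly m = (\<Prod>i<m. [:- r i, 1:])"
    using touchard_poly_roots by blast
  have "r i \<le> 4 * real m" if "i < m" for i
  proof (rule ccontr)
    assume "\<not> r i \<le> 4 * real m"
    then have "poly (touchard_poly m) (r i) > 0"
      using touchard_poly_barrier[of m m] that by simp
    moreover have "poly (touchard_poly m) (r i) = 0" using that by (auto simp: r poly_prod)
    ultimately show False by simp
  qed
  then show ?thesis using r by blast
qed

section \<open>Power sums of the roots\<close>

abbreviation rev_coeff :: "nat \<Rightarrow> nat \<Rightarrow> real" where
  "rev_coeff m j \<equiv> coeff (reflect_poly (touchard_poly m)) j"

lemma coeff_touchard_poly_Suc_0: "coeff (touchard_poly (Suc m)) 0 = 0"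
  by simp

text \<open>For \<open>j \<le> m\<close>, \<open>rev_coeff m j\<close> is \<open>(- 1) ^ j\<close>
  times the Stirling number \<open>S(m, m - j)\<close>, and also \<open>(- 1) ^ j\<close> times the
  \<open>j\<close>-th elementary symmetric function of the roots. This is the Stirling recurrence;
  counting from the top makes each coefficient a polynomial in \<open>m\<close> of degree
  \<open>2 * j\<close>, so the closed forms below follow by induction.\<close>

lemma rev_coeff_Suc:
  "rev_coeff (Suc m) (Suc j) = rev_coeff m (Suc j) - (real m - real j) * rev_coeff m j"
proof -
  consider "j < m" | "j = m" | "j > m" by linarith
  then show ?thesis
  proof cases
    case 1
    then obtain k where "m = Suc (j + k)" using less_imp_Suc_add by blast
    then show ?thesis by (simp add: coeff_reflect_poly coeff_pderiv del: touchard_poly.simps)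
      (simp add: coeff_pderiv algebra_simps)
  qed (simp_all add: coeff_reflect_poly coeff_touchard_poly_Suc_0 del: touchard_poly.simps)
qed

lemma rev_coeff_0 [simp]: "rev_coeff m 0 = 1"
  by (simp add: coeff_reflect_poly)

lemma rev_coeff_1: "rev_coeff m 1 = - (real m * (real m - 1) / 2)"
proof (induction m)
  case (Suc m)
  have "rev_coeff (Suc m) 1 = rev_coeff m 1 - real m"
    using rev_coeff_Suc[of m 0] by (simp del: touchard_poly.simps)
  then show ?case unfolding Suc.IH by (simp add: field_simps)
qed simp

lemma rev_coeff_2: "rev_coeff m 2 = real m * (real m - 1) * (real m - 2) * (3 * real m - 5) / 24"
proof (induction m)
  case (Suc m)
  have "rev_coeff (Suc m) 2 = rev_coeff m 2 - (real m - 1) * rev_coeff m 1"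
    using rev_coeff_Suc[of m 1] by (simp add: eval_nat_numeral del: touchard_poly.simps)
  then show ?case unfolding Suc.IH rev_coeff_1 by (simp add: field_simps)
qed simp

lemma rev_coeff_3:
  "rev_coeff m 3 = - (real m * (real m - 1) * (real m - 2) ^ 2 * (real m - 3) ^ 2 / 48)"
proof (induction m)
  case (Suc m)
  have "rev_coeff (Suc m) 3 = rev_coeff m 3 - (real m - 2) * rev_coeff m 2"
    using rev_coeff_Suc[of m 2] by (simp add: eval_nat_numeral del: touchard_poly.simps)
  then show ?case unfolding Suc.IH rev_coeff_2 by (simp add: field_simps eval_nat_numeral)
qed simp

lemma rev_coeff_4:
  "rev_coeff m 4 = real m * (real m - 1) * (real m - 2) * (real m - 3) * (real m - 4) *
     (15 * real m ^ 3 - 150 * real m ^ 2 + 485 * real m - 502) / 5760"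
proof (induction m)
  case (Suc m)
  have "rev_coeff (Suc m) 4 = rev_coeff m 4 - (real m - 3) * rev_coeff m 3"
    using rev_coeff_Suc[of m 3] by (simp add: eval_nat_numeral del: touchard_poly.simps)
  then show ?case unfolding Suc.IH rev_coeff_3 by (simp add: field_simps eval_nat_numeral)
qed simp

lemma reflect_prod_linear:
  "reflect_poly (\<Prod>i\<in>A. [:- r i, 1 :: real:]) = (\<Prod>i\<in>A. [:1, - r i:])"
proof -
  have "reflect_poly [:- c, 1:] = [:1, - c:]" for c :: real
    by (cases "c = 0") (auto simp: reflect_poly_def Poly_append)
  then show ?thesis by (simp add: reflect_poly_prod)
qed

lemma newton_identities:
  fixes r :: "'a \<Rightarrow> real"
  assumes "finite A"
  defines "p \<equiv> \<lambda>k. \<Sum>i\<in>A. r i ^ k" and "c \<equiv> \<lambda>k. coeff (\<Prod>i\<in>A. [:1, - r i:]) k"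
  shows "c 0 = 1" "c 1 = - p 1" "c 2 = (p 1 ^ 2 - p 2) / 2"
    "c 3 = - (p 1 ^ 3 - 3 * p 1 * p 2 + 2 * p 3) / 6"
    "c 4 = (p 1 ^ 4 - 6 * p 1 ^ 2 * p 2 + 3 * p 2 ^ 2 + 8 * p 1 * p 3 - 6 * p 4) / 24"
proof -
  have "c 0 = 1 \<and> c 1 = - p 1 \<and> c 2 = (p 1 ^ 2 - p 2) / 2 \<and>
    c 3 = - (p 1 ^ 3 - 3 * p 1 * p 2 + 2 * p 3) / 6 \<and>
    c 4 = (p 1 ^ 4 - 6 * p 1 ^ 2 * p 2 + 3 * p 2 ^ 2 + 8 * p 1 * p 3 - 6 * p 4) / 24"
    using assms(1) unfolding c_def p_def
  proof (induction A rule: finite_induct)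
    case (insert a A)
    define Q where "Q = (\<Prod>i\<in>A. [:1, - r i:])"
    define P where "P = (\<lambda>k. \<Sum>i\<in>A. r i ^ k)"
    have P_eq: "(\<Sum>i\<in>A. r i ^ k) = P k" for k by (simp add: P_def)
    have 1: "coeff ([:1, - r a:] * q) 0 = coeff q 0"
      "coeff ([:1, - r a:] * q) (Suc k) = coeff q (Suc k) - r a * coeff q k" for q k
      by (simp_all add: mult.commute[of "[:_, _:]"])
    have 2: "coeff ([:1, - r a:] * Q) 1 = coeff Q 1 - r a * coeff Q 0"
      "coeff ([:1, - r a:] * Q) 2 = coeff Q 2 - r a * coeff Q 1"
      "coeff ([:1, - r a:] * Q) 3 = coeff Q 3 - r a * coeff Q 2"
      "coeff ([:1, - r a:] * Q) 4 = coeff Q 4 - r a * coeff Q 3"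
      using 1(2)[of Q 0] 1(2)[of Q 1] 1(2)[of Q 2] 1(2)[of Q 3]
      by (simp_all only: One_nat_def Suc_1 eval_nat_numeral BitM.simps)
    have IH: "coeff Q 0 = 1" "coeff Q 1 = - P 1" "coeff Q 2 = (P 1 ^ 2 - P 2) / 2"
      "coeff Q 3 = - (P 1 ^ 3 - 3 * P 1 * P 2 + 2 * P 3) / 6"
      "coeff Q 4 = (P 1 ^ 4 - 6 * P 1 ^ 2 * P 2 + 3 * P 2 ^ 2 + 8 * P 1 * P 3 - 6 * P 4) / 24"
      using insert.IH unfolding Q_def P_def by blast+
    show ?case
      unfolding prod.insert[OF insert.hyps] sum.insert[OF insert.hyps] Q_def[symmetric] 1(1) 2
        P_eq IH
      by (intro conjI) (simp_all add: field_simps eval_nat_numeral)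
  qed (simp add: coeff_1 eval_nat_numeral)
  then show "c 0 = 1" "c 1 = - p 1" "c 2 = (p 1 ^ 2 - p 2) / 2"
    "c 3 = - (p 1 ^ 3 - 3 * p 1 * p 2 + 2 * p 3) / 6"
    "c 4 = (p 1 ^ 4 - 6 * p 1 ^ 2 * p 2 + 3 * p 2 ^ 2 + 8 * p 1 * p 3 - 6 * p 4) / 24"
    by auto
qed

text \<open>Only the leading coefficients \<open>5 / 12\<close>, \<open>3 / 8\<close> and
  \<open>167 / 240\<close> reach the asymptotic formula. The exact values show that the lower terms
  are smaller by a factor \<open>1 / m\<close>, uniformly in \<open>m\<close>.\<close>

lemma centered_power_sums:
  assumes "touchard_poly m = (\<Prod>i<m. [:- r i, 1:])"
  defines "c \<equiv> \<lambda>i. r i - (real m - 1) / 2"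
  shows "(\<Sum>i<m. c i) = 0"
    "(\<Sum>i<m. c i ^ 2) = real m * (real m - 1) * (5 * real m - 7) / 12"
    "(\<Sum>i<m. c i ^ 3) = real m * (real m - 1) * (real m - 2) * (3 * real m - 5) / 8"
    "(\<Sum>i<m. c i ^ 4) = 167 / 240 * real m ^ 5 - 55 / 12 * real m ^ 4 + 91 / 8 * real m ^ 3
        - 149 / 12 * real m ^ 2 + 1183 / 240 * real m"
proof -
  define a where "a = (real m - 1) / 2"
  define p where "p = (\<lambda>k. \<Sum>i<m. r i ^ k)"
  have rc: "rev_coeff m k = coeff (\<Prod>i<m. [:1, - r i:]) k" for k
    by (simp only: assms(1) reflect_prod_linear)
  have N: "rev_coeff m 1 = - p 1" "rev_coeff m 2 = (p 1 ^ 2 - p 2) / 2"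
    "rev_coeff m 3 = - (p 1 ^ 3 - 3 * p 1 * p 2 + 2 * p 3) / 6"
    "rev_coeff m 4 = (p 1 ^ 4 - 6 * p 1 ^ 2 * p 2 + 3 * p 2 ^ 2 + 8 * p 1 * p 3 - 6 * p 4) / 24"
    unfolding rc p_def by (rule newton_identities[OF finite_lessThan])+
  have p1: "p 1 = real m * (real m - 1) / 2"
    using N(1) rev_coeff_1[of m] by simp
  have "p 2 = p 1 ^ 2 - 2 * rev_coeff m 2" using N(2) by simp
  then have p2: "p 2 = 2 / 3 * real m ^ 3 - 3 / 2 * real m ^ 2 + 5 / 6 * real m"
    unfolding rev_coeff_2 p1 by (simp add: field_simps power2_eq_square power3_eq_cube)
  have "p 3 = (- 6 * rev_coeff m 3 - p 1 ^ 3 + 3 * p 1 * p 2) / 2" using N(3) by simp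
  then have p3: "p 3 = 9 / 8 * real m ^ 4 - 17 / 4 * real m ^ 3 + 43 / 8 * real m ^ 2 - 9 / 4 * real m"
    unfolding rev_coeff_3 p1 p2 by (simp add: field_simps eval_nat_numeral)
  have "p 4 = (p 1 ^ 4 - 6 * p 1 ^ 2 * p 2 + 3 * p 2 ^ 2 + 8 * p 1 * p 3 - 24 * rev_coeff m 4) / 6"
    using N(4) by simp
  then have p4: "p 4 = 32 / 15 * real m ^ 5 - 71 / 6 * real m ^ 4 + 25 * real m ^ 3
      - 71 / 3 * real m ^ 2 + 251 / 30 * real m"
    unfolding rev_coeff_4 p1 p2 p3 by (simp add: field_simps eval_nat_numeral)
  have s: "(\<Sum>i<m. c i) = p 1 - real m * a"
    by (simp add: c_def a_def p_def sum_subtractf)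
  show "(\<Sum>i<m. c i) = 0" unfolding s p1 a_def by simp
  have "(\<Sum>i<m. c i ^ 2) = (\<Sum>i<m. r i ^ 2 - 2 * a * r i ^ 1 + a ^ 2)"
    by (intro sum.cong refl) (simp add: c_def a_def power2_eq_square field_simps)
  also have "\<dots> = p 2 - 2 * a * p 1 + real m * a ^ 2"
    by (simp add: p_def sum.distrib sum_subtractf sum_distrib_left)
  finally show "(\<Sum>i<m. c i ^ 2) = real m * (real m - 1) * (5 * real m - 7) / 12"
    unfolding p1 p2 a_def by (simp add: field_simps eval_nat_numeral)
  have "(r i - a) ^ 3 = r i ^ 3 - 3 * a * r i ^ 2 + 3 * a ^ 2 * r i ^ 1 - a ^ 3" for i
    by (simp add: eval_nat_numeral algebra_simps)
  then have "(\<Sum>i<m. c i ^ 3) = (\<Sum>i<m. r i ^ 3 - 3 * a * r i ^ 2 + 3 * a ^ 2 * r i ^ 1 - a ^ 3)"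
    by (simp add: c_def a_def)
  also have "\<dots> = p 3 - 3 * a * p 2 + 3 * a ^ 2 * p 1 - real m * a ^ 3"
    by (simp add: p_def sum.distrib sum_subtractf sum_distrib_left)
  finally show "(\<Sum>i<m. c i ^ 3) = real m * (real m - 1) * (real m - 2) * (3 * real m - 5) / 8"
    unfolding p1 p2 p3 a_def by (simp add: field_simps eval_nat_numeral)
  have "(r i - a) ^ 4 = r i ^ 4 - 4 * a * r i ^ 3 + 6 * a ^ 2 * r i ^ 2 - 4 * a ^ 3 * r i ^ 1 + a ^ 4" for i
    by (simp add: eval_nat_numeral algebra_simps)
  then have "(\<Sum>i<m. c i ^ 4) =
      (\<Sum>i<m. r i ^ 4 - 4 * a * r i ^ 3 + 6 * a ^ 2 * r i ^ 2 - 4 * a ^ 3 * r i ^ 1 + a ^ 4)"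
    by (simp add: c_def a_def)
  also have "\<dots> = p 4 - 4 * a * p 3 + 6 * a ^ 2 * p 2 - 4 * a ^ 3 * p 1 + real m * a ^ 4"
    by (simp add: p_def sum.distrib sum_subtractf sum_distrib_left)
  finally show "(\<Sum>i<m. c i ^ 4) = 167 / 240 * real m ^ 5 - 55 / 12 * real m ^ 4 + 91 / 8 * real m ^ 3
        - 149 / 12 * real m ^ 2 + 1183 / 240 * real m"
    unfolding p1 p2 p3 p4 a_def by (simp add: field_simps eval_nat_numeral)
qed

section \<open>Gamma integrals and elementary estimates\<close>

lemma has_integral_shift_UNIV:
  fixes f :: "real \<Rightarrow> real"
  assumes "f \<in> borel_measurable borel" "\<And>x. 0 \<le> f x" "(f has_integral I) UNIV"
  shows "((\<lambda>x. f (x - a)) has_integral I) UNIV"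
proof (rule nn_integral_has_integral)
  have "(\<integral>\<^sup>+x. f x \<partial>lborel) = ennreal \<bar>1\<bar> * (\<integral>\<^sup>+x. f (- a + 1 * x) \<partial>lborel)"
    by (rule nn_integral_real_affine) (use assms(1) in simp_all)
  also have "\<dots> = (\<integral>\<^sup>+x. f (x - a) \<partial>lborel)"
    by (simp only: abs_one ennreal_1 mult_1_left mult_1_right uminus_add_conv_diff)
  finally have "(\<integral>\<^sup>+x. f (x - a) \<partial>lborel) = (\<integral>\<^sup>+x. f x \<partial>lborel)"
    by (rule sym)
  also have "\<dots> = ennreal I"
    by (rule nn_integral_has_integral_lborel) (rule assms)+
  finally show "(\<integral>\<^sup>+x. f (x - a) \<partial>lborel) = ennreal I" .
  show "0 \<le> I" by (rule has_integral_nonneg[OF assms(3)]) (rule assms(2))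
  show "(\<lambda>x. f (x - a)) \<in> borel_measurable borel"
    using assms(1) by measurable
qed (rule assms(2))

text \<open>An unnormalised Gamma density moved to start at \<open>a\<close>, the mean of the roots,
  and extended by \<open>0\<close> so that all comparisons take place on the whole line.\<close>

definition gamma_weight :: "real \<Rightarrow> real \<Rightarrow> real \<Rightarrow> real" where
  "gamma_weight a s x = (if x \<ge> a then (x - a) powr s * exp (- (x - a)) else 0)"

lemma gamma_weight_nonneg: "gamma_weight a s x \<ge> 0"
  by (simp add: gamma_weight_def)

lemma gamma_weight_mult:
  assumes "x \<ge> a"
  shows "gamma_weight a s x * (x - a) = gamma_weight a (s + 1) x"
  using assms powr_mult_base[of "x - a" s] by (simp add: gamma_weight_def add.commute mult.commute mult.left_commute)

lemma has_integral_gamma_weight: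
  assumes "s > - 1"
  shows "(gamma_weight a s has_integral Gamma (s + 1)) UNIV"
proof -
  have "((\<lambda>t. t powr (s + 1 - 1) / exp t) has_integral Gamma (s + 1)) {0..}"
    using assms by (intro Gamma_integral_real) simp
  then have "((\<lambda>x. if x \<in> {0..} then x powr (s + 1 - 1) / exp x else 0) has_integral Gamma (s + 1)) UNIV"
    by (simp only: has_integral_restrict_UNIV)
  also have "(\<lambda>x. if x \<in> {0..} then x powr (s + 1 - 1) / exp x else 0) = gamma_weight 0 s"
    by (auto simp: gamma_weight_def exp_minus field_simps)
  finally have "((\<lambda>x. gamma_weight 0 s (x - a)) has_integral Gamma (s + 1)) UNIV"
    by (rule has_integral_shift_UNIV[rotated 2])
       (auto simp: gamma_weight_nonneg gamma_weight_def[abs_def] intro!: measurable_If)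
  also have "(\<lambda>x. gamma_weight 0 s (x - a)) = gamma_weight a s"
    by (auto simp: gamma_weight_def)
  finally show ?thesis .
qed

lemma has_integral_poly_laplace:
  "((\<lambda>x. if x \<ge> 0 then exp (- x) * poly p x else 0) has_integral poly_laplace p) UNIV"
proof -
  have "((\<lambda>x. coeff p i * gamma_weight 0 (real i) x) has_integral coeff p i * fact i) UNIV" for i
    using has_integral_gamma_weight[of "real i" 0]
    by (intro has_integral_mult_right) (simp add: Gamma_fact[symmetric] add.commute)
  then have "((\<lambda>x. \<Sum>i\<le>degree p. coeff p i * gamma_weight 0 (real i) x) has_integral poly_laplace p) UNIV"
    unfolding poly_laplace_def by (intro has_integral_sum) auto
  then show ?thesis
  \<comment> \<open>At \<open>x = 0\<close> the constant term is lost because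
    \<open>0 powr 0 = 0\<close>; one point does not affect the integral.\<close>
  proof (rule has_integral_spike[where S = "{0}", rotated 2])
    fix x :: real assume "x \<in> UNIV - {0}"
    then show "(if x \<ge> 0 then exp (- x) * poly p x else 0) =
        (\<Sum>i\<le>degree p. coeff p i * gamma_weight 0 (real i) x)"
      by (auto simp: gamma_weight_def powr_realpow poly_altdef sum_distrib_left mult_ac)
  qed simp
qed

text \<open>The density with exponent \<open>s\<close> has mean and variance both equal to
  \<open>s + 1\<close>, so the bracket is squared bias plus variance, over
  \<open>N ^ 2\<close>.\<close>

lemma has_integral_gamma_weight_second_moment:
  assumes "s > - 1" "N \<noteq> 0"
  shows "((\<lambda>x. gamma_weight a s x * ((x - a) / N - 1) ^ 2) has_integral
           Gamma (s + 1) * (((s + 1 - N) ^ 2 + (s + 1)) / N ^ 2)) UNIV"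
proof -
  have "Gamma (s + 1 + 1) = (s + 1) * Gamma (s + 1)"
    "Gamma (s + 2 + 1) = (s + 2) * ((s + 1) * Gamma (s + 1))"
    using Gamma_plus1[of "s + 1"] Gamma_plus1[of "s + 2"] assms
    by (auto simp: nonpos_Ints_def algebra_simps)
  then have "((\<lambda>x. 1 / N ^ 2 * gamma_weight a (s + 2) x - 2 / N * gamma_weight a (s + 1) x
        + gamma_weight a s x) has_integral
      1 / N ^ 2 * ((s + 2) * ((s + 1) * Gamma (s + 1))) - 2 / N * ((s + 1) * Gamma (s + 1))
        + Gamma (s + 1)) UNIV"
    using has_integral_gamma_weight[of "s + 2" a] has_integral_gamma_weight[of "s + 1" a]
      has_integral_gamma_weight[of s a] assms
    by (intro has_integral_add has_integral_diff has_integral_mult_right) auto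
  moreover have "1 / N ^ 2 * gamma_weight a (s + 2) x - 2 / N * gamma_weight a (s + 1) x
        + gamma_weight a s x = gamma_weight a s x * ((x - a) / N - 1) ^ 2" for x
  proof (cases "x \<ge> a")
    case True
    then have "gamma_weight a (s + 1) x = gamma_weight a s x * (x - a)"
      "gamma_weight a (s + 2) x = gamma_weight a s x * (x - a) * (x - a)"
      using gamma_weight_mult[of a x s] gamma_weight_mult[of a x "s + 1"] by (simp_all add: add.assoc)
    show ?thesis
      unfolding \<open>gamma_weight a (s + 1) x = _\<close> \<open>gamma_weight a (s + 2) x = _\<close>
      using assms by (simp add: field_simps power2_eq_square)
  qed (simp add: gamma_weight_def)
  moreover have "1 / N ^ 2 * ((s + 2) * ((s + 1) * Gamma (s + 1))) - 2 / N * ((s + 1) * Gamma (s + 1))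
        + Gamma (s + 1) = Gamma (s + 1) * (((s + 1 - N) ^ 2 + (s + 1)) / N ^ 2)"
    using assms by (simp add: field_simps power2_eq_square)
  ultimately show ?thesis by simp
qed

text \<open>\<open>ln_Gamma\<close> grows by exactly \<open>ln x\<close> from \<open>x\<close> to
  \<open>x + 1\<close>, so its increasing derivative takes the value \<open>ln x\<close> in
  between.\<close>

lemma Digamma_bounds:
  assumes "x > (0::real)"
  shows "ln x \<le> Digamma (x + 1)" "Digamma x \<le> ln x"
proof -
  have D: "(ln_Gamma has_field_derivative Digamma z) (at z)" if "z \<ge> x" for z :: real
    using that assms by (auto intro!: derivative_eq_intros)
  have "\<exists>z. x < z \<and> z < x + 1 \<and> ln_Gamma (x + 1) - ln_Gamma x = (x + 1 - x) * Digamma z"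
    by (rule MVT2) (auto intro: D)
  then obtain z where z: "x < z" "z < x + 1" "ln_Gamma (x + 1) - ln_Gamma x = Digamma z" by auto
  have "Gamma (x + 1) = x * Gamma x" using Gamma_plus1[of x] assms by (auto simp: nonpos_Ints_def)
  then have "ln_Gamma (x + 1) - ln_Gamma x = ln x"
    using assms Gamma_real_pos[of x] by (simp add: ln_Gamma_real_pos ln_mult_pos)
  then have "Digamma z = ln x" using z by simp
  then show "ln x \<le> Digamma (x + 1)" "Digamma x \<le> ln x"
    using z assms Digamma_real_mono[of z "x + 1"] Digamma_real_mono[of x z] by auto
qed

text \<open>The derivative of \<open>d\<close> in \<open>S\<close> compares
  \<open>Digamma (N + 1 + S)\<close> with \<open>ln N + S / N\<close>, the linearised logarithm. The
  quadratic error of the logarithm costs \<open>S ^ 2 / N ^ 2\<close> below, the extra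
  \<open>1\<close> in the argument costs \<open>1 / N\<close> above.\<close>

lemma ln_Gamma_increment:
  assumes "N > (0::real)" "S \<ge> 0" "S \<le> N"
  defines "d \<equiv> ln_Gamma (N + 1 + S) - ln_Gamma (N + 1) - S * ln N - S ^ 2 / (2 * N)"
  shows "- (S ^ 3 / N ^ 2) \<le> d" "d \<le> S / N"
proof -
  define f where "f = (\<lambda>t. ln_Gamma (N + 1 + t) - t * ln N - t ^ 2 / (2 * N))"
  have D: "(f has_field_derivative Digamma (N + 1 + t) - ln N - t / N) (at t)" if "t \<ge> 0" for t
    unfolding f_def using that assms by (auto intro!: derivative_eq_intros simp: field_simps)
  have up: "Digamma (N + 1 + t) - ln N - t / N \<le> 1 / N" if "t \<ge> 0" for t
  proof -
    have "Digamma (N + 1 + t) \<le> ln (N + 1 + t)" using that assms by (intro Digamma_bounds) auto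
    also have "\<dots> = ln N + ln (1 + (1 + t) / N)"
    proof -
      have "N + 1 + t = N * (1 + (1 + t) / N)" using assms by (simp add: field_simps)
      moreover have "1 + (1 + t) / N > 0" using that assms by (intro add_pos_nonneg) auto
      ultimately show ?thesis using assms(1) by (metis ln_mult_pos)
    qed
    also have "ln (1 + (1 + t) / N) \<le> (1 + t) / N"
      using that assms by (intro ln_add_one_self_le_self) auto
    finally show ?thesis by (simp add: add_divide_distrib)
  qed
  have low: "- (t ^ 2 / N ^ 2) \<le> Digamma (N + 1 + t) - ln N - t / N" if "t \<ge> 0" "t \<le> N" for t
  proof -
    have "t / N - (t / N) ^ 2 \<le> ln (1 + t / N)"
      using that assms by (intro ln_one_plus_pos_lower_bound) auto
    then have "ln N + t / N - t ^ 2 / N ^ 2 \<le> ln N + ln (1 + t / N)"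
      by (simp add: power_divide)
    also have "\<dots> = ln (N + t)"
    proof -
      have "N + t = N * (1 + t / N)" using assms by (simp add: field_simps)
      moreover have "1 + t / N > 0" using that assms by (intro add_pos_nonneg) auto
      ultimately show ?thesis using assms(1) by (metis ln_mult_pos)
    qed
    also have "\<dots> \<le> Digamma (N + 1 + t)"
      using Digamma_bounds(1)[of "N + t"] that assms by (simp add: add_ac)
    finally show ?thesis by simp
  qed
  have d: "d = f S - f 0" by (simp add: d_def f_def)
  show "- (S ^ 3 / N ^ 2) \<le> d" "d \<le> S / N"
  proof (atomize (full), cases "S = 0")
    case False
    then have "0 < S" using assms by simp
    then have "\<exists>z. 0 < z \<and> z < S \<and> f S - f 0 = (S - 0) * (Digamma (N + 1 + z) - ln N - z / N)"
      by (rule MVT2) (auto intro: D)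
    then obtain z where z: "0 < z" "z < S" "d = S * (Digamma (N + 1 + z) - ln N - z / N)"
      using d by auto
    have "S * - (z ^ 2 / N ^ 2) \<le> d"
      unfolding z(3) using z \<open>0 < S\<close> low[of z] assms(3) by (intro mult_left_mono) auto
    moreover have "S * (z ^ 2 / N ^ 2) \<le> S * (S ^ 2 / N ^ 2)"
      using z \<open>0 < S\<close> by (intro mult_left_mono divide_right_mono power_mono) auto
    moreover have "S * (S ^ 2 / N ^ 2) = S ^ 3 / N ^ 2" by (simp add: power2_eq_square power3_eq_cube)
    moreover have "d \<le> S * (1 / N)"
      unfolding z(3) using z \<open>0 < S\<close> up[of z] by (intro mult_left_mono) auto
    ultimately show "- (S ^ 3 / N ^ 2) \<le> d \<and> d \<le> S / N" by auto
  qed (simp add: d)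
qed

text \<open>The derivative of the difference collapses to \<open>- (s ^ 4 / (1 - s))\<close>, and
  \<open>1 - s \<ge> 1 / 2\<close>.\<close>

lemma ln_one_minus_approx:
  fixes t :: real
  assumes "\<bar>t\<bar> \<le> 1 / 2"
  shows "\<bar>ln (1 - t) + t + t ^ 2 / 2 + t ^ 3 / 3 + t ^ 4 / 4\<bar> \<le> 2 * \<bar>t\<bar> ^ 5"
proof -
  define f where "f = (\<lambda>t :: real. ln (1 - t) + t + t ^ 2 / 2 + t ^ 3 / 3 + t ^ 4 / 4)"
  have D: "(f has_field_derivative - (s ^ 4 / (1 - s))) (at s)" if "\<bar>s\<bar> \<le> 1 / 2" for s
  proof -
    have "(f has_field_derivative - 1 / (1 - s) + 1 + s + s ^ 2 + s ^ 3) (at s)"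
      unfolding f_def using that
      by (auto intro!: derivative_eq_intros simp: power2_eq_square power3_eq_cube abs_le_iff)
    also have "- 1 / (1 - s) + 1 + s + s ^ 2 + s ^ 3 = - (s ^ 4 / (1 - s))"
      using that by (simp add: field_simps eval_nat_numeral)
    finally show ?thesis .
  qed
  have bound: "\<bar>- (s ^ 4 / (1 - s))\<bar> \<le> 2 * \<bar>t\<bar> ^ 4" if "\<bar>s\<bar> \<le> \<bar>t\<bar>" for s
  proof -
    have s: "1 - s \<ge> 1 / 2" using that assms by (simp add: abs_le_iff)
    have "\<bar>- (s ^ 4 / (1 - s))\<bar> = \<bar>s\<bar> ^ 4 / (1 - s)" using s by (simp add: power_abs abs_mult)
    also have "\<dots> \<le> \<bar>t\<bar> ^ 4 / (1 / 2)"
      using that s by (intro frac_le power_mono) auto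
    finally show ?thesis by simp
  qed
  have "norm (f t - f 0) \<le> 2 * \<bar>t\<bar> ^ 4 * norm (t - 0)"
    by (rule field_differentiable_bound[where S = "{- \<bar>t\<bar>..\<bar>t\<bar>}" and f' = "\<lambda>s. - (s ^ 4 / (1 - s))"])
       (use assms bound in \<open>auto intro!: DERIV_subset[OF D] simp: abs_le_iff\<close>)
  then show ?thesis by (simp add: f_def eval_nat_numeral mult_ac)
qed

text \<open>The tangent at \<open>u = 1\<close> to \<open>1 / u ^ k\<close> as a function of \<open>ln u\<close>.\<close>

lemma inverse_power_ge: "u > (0::real) \<Longrightarrow> 1 - real k * ln u \<le> 1 / u ^ k"
  using ln_le_minus_one[of "1 / u ^ k"] by (simp add: ln_div ln_realpow)

text \<open>\<open>1 / u ^ k\<close> equals \<open>1 - k * (u - 1) + Q * (u - 1) ^ 2\<close>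
  exactly, where \<open>Q\<close> is a polynomial in \<open>1 / u \<le> 4\<close>, and
  \<open>ln u \<le> u - 1\<close>. The constant is the case \<open>k = 4\<close>:
  \<open>448 = 4 * 4 + 3 * 16 + 2 * 64 + 256\<close>.\<close>

lemma inverse_power_le:
  fixes u :: real
  assumes "u \<ge> 1 / 4" "k \<in> {2, 3, 4}"
  shows "1 / u ^ k \<le> 1 - real k * ln u + 448 * (u - 1) ^ 2"
proof -
  define v where "v = 1 / u"
  have u: "u > 0" using assms by simp
  have v: "0 < v" "v \<le> 4" using assms by (auto simp: v_def field_simps)
  have uv: "u * v = 1" using u by (simp add: v_def)
  have pw: "v ^ 2 \<le> 16" "v ^ 3 \<le> 64" "v ^ 4 \<le> 256"
    using power_mono[OF v(2), of 2] power_mono[OF v(2), of 3] power_mono[OF v(2), of 4] v by auto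
  have pos: "v ^ 2 \<ge> 0" "v ^ 3 \<ge> 0" "v ^ 4 \<ge> 0" using v by auto
  define Q where "Q = (if k = 2 then 2 * v + v ^ 2 else if k = 3 then 3 * v + 2 * v ^ 2 + v ^ 3
     else 4 * v + 3 * v ^ 2 + 2 * v ^ 3 + v ^ 4)"
  have Q: "Q \<le> 448" using pw pos v by (auto simp: Q_def)
  have "1 / u ^ k = 1 - real k * (u - 1) + Q * (u - 1) ^ 2"
    using assms(2) u by (auto simp: Q_def v_def field_simps eval_nat_numeral)
  moreover have "Q * (u - 1) ^ 2 \<le> 448 * (u - 1) ^ 2" using Q by (intro mult_right_mono) auto
  moreover have "real k * ln u \<le> real k * (u - 1)"
    using ln_le_minus_one[OF u] by (intro mult_left_mono) auto
  ultimately show ?thesis by linarith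
qed

section \<open>Bounds for the Laplace integral\<close>

locale touchard_roots =
  fixes m n :: nat and r :: "nat \<Rightarrow> real"
  assumes m_ge: "m \<ge> 1" and n_ge: "n \<ge> 64"
    and r_bounds: "\<And>i. i < m \<Longrightarrow> 0 \<le> r i \<and> r i \<le> 4 * real m"
    and r_prod: "touchard_poly m = (\<Prod>i<m. [:- r i, 1:])"
begin

text \<open>Centring the roots at their mean \<open>a\<close> removes the term of order one in \<open>ln (P x / (x - a) ^ m)\<close>.
  With \<open>u = (x - a) / N\<close>, the next ones contribute \<open>- \<kappa> k / u ^ k\<close> to the logarithm of the integrand, and
  replacing \<open>1 / u ^ k\<close> by its tangent \<open>1 - k * ln u\<close> turns them into the constant factor
  \<open>exp (- \<kappa>s)\<close> and the power \<open>u powr S\<close>.\<close>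

definition N :: real where "N = real m * real n"
definition a :: real where "a = (real m - 1) / 2"
definition c :: "nat \<Rightarrow> real" where "c i = r i - a"
definition q :: "nat \<Rightarrow> real" where "q k = (\<Sum>i<m. c i ^ k)"
definition \<kappa> :: "nat \<Rightarrow> real" where "\<kappa> k = real n * q k / (real k * N ^ k)"
definition \<kappa>s :: real where "\<kappa>s = \<kappa> 2 + \<kappa> 3 + \<kappa> 4"
definition S :: real where "S = 2 * \<kappa> 2 + 3 * \<kappa> 3 + 4 * \<kappa> 4"
text \<open>\<open>m * n\<close> times the Taylor remainder \<open>2 * (16 / n) ^ 5\<close>. In
  \<open>G\<close>, the power of \<open>N\<close> accounts for passing from \<open>u powr S\<close>
  to \<open>(x - a) powr S\<close>.\<close>

definition \<rho> :: real where "\<rho> = 2 * 16 ^ 5 * real m / real n ^ 4"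
definition G :: real where "G = exp (- a - \<kappa>s) * N powr (- S)"

lemma N_pos: "N > 0" and m_pos: "real m > 0" and n_pos: "real n > 0" and n_ge': "real n \<ge> 64"
  and m_ge': "real m \<ge> 1" and N_nat: "N = real (m * n)"
  using m_ge n_ge by (auto simp: N_def)

lemma N_ge: "N \<ge> 64 * real m"
  using n_ge' m_pos mult_left_mono[of 64 "real n" "real m"] by (simp add: N_def mult.commute)

lemma a_bounds: "0 \<le> a" "a \<le> real m / 2"
  using m_ge' by (auto simp: a_def)

lemma c_bound: "i < m \<Longrightarrow> \<bar>c i\<bar> \<le> 4 * real m"
  using r_bounds[of i] a_bounds m_ge' by (auto simp: c_def)

lemma q_eq: "q 1 = 0" "q 2 = real m * (real m - 1) * (5 * real m - 7) / 12"
  "q 3 = real m * (real m - 1) * (real m - 2) * (3 * real m - 5) / 8"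
  "q 4 = 167 / 240 * real m ^ 5 - 55 / 12 * real m ^ 4 + 91 / 8 * real m ^ 3
        - 149 / 12 * real m ^ 2 + 1183 / 240 * real m"
  using centered_power_sums[OF r_prod] by (simp_all add: q_def c_def a_def)

text \<open>The signs matter because inequalities for \<open>1 / u ^ k\<close> get multiplied by
  these sums. For the odd one the closed form decides: it is zero for \<open>m = 1, 2\<close> and
  positive afterwards.\<close>

lemma q_nonneg: "q 2 \<ge> 0" "q 3 \<ge> 0" "q 4 \<ge> 0"
proof -
  show "q 2 \<ge> 0" "q 4 \<ge> 0" unfolding q_def by (auto intro!: sum_nonneg)
  show "q 3 \<ge> 0"
  proof (cases "m \<le> 2")
    case True
    then have "m = 1 \<or> m = 2" using m_ge by auto
    then show ?thesis unfolding q_eq by auto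
  next
    case False
    then show ?thesis unfolding q_eq by simp
  qed
qed

lemma q_bound: "q k \<le> real m * (4 * real m) ^ k"
proof -
  have "q k \<le> (\<Sum>i<m. (4 * real m) ^ k)"
    unfolding q_def
  proof (rule sum_mono)
    fix i assume "i \<in> {..<m}"
    then have "\<bar>c i ^ k\<bar> \<le> (4 * real m) ^ k"
      unfolding power_abs using c_bound[of i] by (intro power_mono) auto
    then show "c i ^ k \<le> (4 * real m) ^ k" by simp
  qed
  then show ?thesis by simp
qed

lemma \<kappa>_nonneg: "\<kappa> 2 \<ge> 0" "\<kappa> 3 \<ge> 0" "\<kappa> 4 \<ge> 0"
  using q_nonneg N_pos by (auto simp: \<kappa>_def)

lemma \<kappa>_le: "\<kappa> 2 \<le> 8 * real m / real n" "\<kappa> 3 \<le> 22 * real m / real n ^ 2"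
    "\<kappa> 4 \<le> 64 * real m / real n ^ 3"
proof -
  have *: "\<kappa> k \<le> real n * (real m * (4 * real m) ^ k) / (real k * N ^ k)" for k
    unfolding \<kappa>_def using q_bound N_pos by (intro divide_right_mono mult_left_mono) auto
  show "\<kappa> 2 \<le> 8 * real m / real n"
    using *[of 2] m_pos n_pos by (simp add: N_def field_simps eval_nat_numeral)
  have "\<kappa> 3 \<le> 64 / 3 * (real m / real n ^ 2)"
    using *[of 3] m_pos n_pos by (simp add: N_def field_simps eval_nat_numeral)
  also have "\<dots> \<le> 22 * (real m / real n ^ 2)" by (intro mult_right_mono) auto
  finally show "\<kappa> 3 \<le> 22 * real m / real n ^ 2" by simp
  show "\<kappa> 4 \<le> 64 * real m / real n ^ 3"
    using *[of 4] m_pos n_pos by (simp add: N_def field_simps eval_nat_numeral)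
qed

lemma \<kappa>s_nonneg: "\<kappa>s \<ge> 0" and S_nonneg: "S \<ge> 0"
  using \<kappa>_nonneg by (auto simp: \<kappa>s_def S_def)

text \<open>\<open>94 = 8 + 22 + 64\<close> and
  \<open>338 = 2 * 8 + 3 * 22 + 4 * 64\<close>.\<close>

lemma \<kappa>s_le: "\<kappa>s \<le> 94 * real m / real n" and S_le: "S \<le> 338 * real m / real n"
proof -
  have "22 * real m / real n ^ 2 \<le> 22 * real m / real n" "64 * real m / real n ^ 3 \<le> 64 * real m / real n"
    using n_ge' by (auto intro!: divide_left_mono self_le_power)
  then have "\<kappa> 2 \<le> 8 * (real m / real n)" "\<kappa> 3 \<le> 22 * (real m / real n)" "\<kappa> 4 \<le> 64 * (real m / real n)"
    using \<kappa>_le by auto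
  then show "\<kappa>s \<le> 94 * real m / real n" "S \<le> 338 * real m / real n"
    unfolding \<kappa>s_def S_def times_divide_eq_right[symmetric] by linarith+
qed

lemma S_le_N: "S \<le> N"
proof -
  have "338 * real m / real n \<le> real m * real n"
  proof -
    have "338 * real m \<le> real m * (real n * real n)"
      using mult_mono[of 64 "real n" 64 "real n"] n_ge' m_pos by (simp add: mult.commute)
    then show ?thesis using n_pos by (simp add: field_simps)
  qed
  then show ?thesis using S_le by (simp add: N_def)
qed

lemma u_ge:
  assumes "x \<ge> N / 2"
  shows "(x - a) / N \<ge> 1 / 4" "x - a \<ge> N / 4"
proof -
  have "a \<le> N / 4"
    using a_bounds N_ge by simp
  then show "x - a \<ge> N / 4" using assms by simp
  then show "(x - a) / N \<ge> 1 / 4" using N_pos by (simp add: field_simps)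
qed

lemma integrand_eq:
  assumes x: "x \<ge> N / 2"
  defines "u \<equiv> (x - a) / N"
  shows "\<exists>e. \<bar>e\<bar> \<le> \<rho> \<and> exp (- x) * poly (touchard_poly m) x ^ n =
    exp (- a) * (exp (- (x - a)) * (x - a) ^ (m * n)) *
    exp (- (\<kappa> 2 * (1 / u ^ 2)) - \<kappa> 3 * (1 / u ^ 3) - \<kappa> 4 * (1 / u ^ 4) + e)"
proof -
  define y where "y = x - a"
  have y: "y \<ge> N / 4" "y > 0" using u_ge[OF x] N_pos by (auto simp: y_def)
  \<comment> \<open>\<open>t i\<close> is at most \<open>4 * m / (N / 4) = 16 / n\<close>, which
    gives the constant in \<open>\<rho>\<close>.\<close>
  define t where "t = (\<lambda>i. c i / y)"
  have t: "\<bar>t i\<bar> \<le> 16 / real n" if "i < m" for i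
  proof -
    have "\<bar>c i\<bar> / y \<le> 4 * real m / (N / 4)"
      using c_bound[OF that] y N_pos by (intro frac_le) auto
    also have "\<dots> = 16 / real n" using m_pos n_pos by (simp add: N_def field_simps)
    finally show ?thesis using y by (simp add: t_def)
  qed
  have n16: "16 / real n \<le> 1 / 4" using n_ge' by (simp add: field_simps)
  have t2: "\<bar>t i\<bar> \<le> 1 / 2" if "i < m" for i using t[OF that] n16 by simp
  define R where "R = (\<lambda>i. ln (1 - t i) + t i + t i ^ 2 / 2 + t i ^ 3 / 3 + t i ^ 4 / 4)"
  have R: "\<bar>R i\<bar> \<le> 2 * (16 / real n) ^ 5" if "i < m" for i
  proof -
    have "\<bar>R i\<bar> \<le> 2 * \<bar>t i\<bar> ^ 5" unfolding R_def by (rule ln_one_minus_approx) (rule t2[OF that])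
    also have "\<dots> \<le> 2 * (16 / real n) ^ 5" using t[OF that] by (intro mult_left_mono power_mono) auto
    finally show ?thesis .
  qed
  define e where "e = real n * (\<Sum>i<m. R i)"
  have "\<bar>e\<bar> \<le> real n * (\<Sum>i<m. 2 * (16 / real n) ^ 5)"
    unfolding e_def abs_mult using R by (intro mult_mono order_trans[OF sum_abs] sum_mono) auto
  also have "\<dots> = \<rho>" using n_pos by (simp add: \<rho>_def field_simps eval_nat_numeral)
  finally have e: "\<bar>e\<bar> \<le> \<rho>" .
  have sum_t: "(\<Sum>i<m. t i ^ k) = q k / y ^ k" for k
    by (simp add: t_def q_def power_divide sum_divide_distrib)
  have ln_eq: "(\<Sum>i<m. ln (1 - t i)) = (\<Sum>i<m. R i) - q 2 / y ^ 2 / 2 - q 3 / y ^ 3 / 3 - q 4 / y ^ 4 / 4"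
  proof -
    have "(\<Sum>i<m. ln (1 - t i)) = (\<Sum>i<m. R i - t i ^ 1 - t i ^ 2 / 2 - t i ^ 3 / 3 - t i ^ 4 / 4)"
      by (intro sum.cong) (auto simp: R_def)
    also have "\<dots> = (\<Sum>i<m. R i) - q 1 / y ^ 1 - q 2 / y ^ 2 / 2 - q 3 / y ^ 3 / 3 - q 4 / y ^ 4 / 4"
      unfolding sum_t[symmetric] by (simp add: sum_subtractf sum_divide_distrib)
    finally show ?thesis by (simp add: q_eq(1) del: One_nat_def)
  qed
  have \<kappa>u: "real n * (q k / y ^ k / real k) = \<kappa> k * (1 / u ^ k)" if "k > 0" for k
    using y N_pos that by (simp add: \<kappa>_def u_def y_def[symmetric] power_divide field_simps)
  have exp_ln_t: "exp (ln (1 - t i)) = 1 - t i" if "i < m" for i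
    using t2[OF that] by (simp add: abs_le_iff)
  have "poly (touchard_poly m) x = (\<Prod>i<m. y * (1 - t i))"
    unfolding r_prod poly_prod using y by (intro prod.cong) (auto simp: t_def c_def y_def field_simps)
  also have "\<dots> = y ^ m * (\<Prod>i<m. exp (ln (1 - t i)))"
    unfolding prod.distrib using exp_ln_t by simp
  also have "\<dots> = y ^ m * exp (\<Sum>i<m. ln (1 - t i))" by (simp add: exp_sum)
  finally have "poly (touchard_poly m) x ^ n = y ^ (m * n) * exp (real n * (\<Sum>i<m. ln (1 - t i)))"
    by (simp add: power_mult_distrib power_mult exp_of_nat_mult)
  also have "real n * (\<Sum>i<m. ln (1 - t i)) =
      - (\<kappa> 2 * (1 / u ^ 2)) - \<kappa> 3 * (1 / u ^ 3) - \<kappa> 4 * (1 / u ^ 4) + e"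
    using \<kappa>u[of 2] \<kappa>u[of 3] \<kappa>u[of 4] unfolding ln_eq e_def by (simp add: right_diff_distrib)
  finally have "poly (touchard_poly m) x ^ n = y ^ (m * n) * exp (- (\<kappa> 2 * (1 / u ^ 2))
      - \<kappa> 3 * (1 / u ^ 3) - \<kappa> 4 * (1 / u ^ 4) + e)" .
  moreover have "exp (- x) = exp (- a) * exp (- y)" by (simp add: y_def exp_add[symmetric])
  ultimately show ?thesis using e by (intro exI[of _ e]) (simp add: y_def)
qed

text \<open>The right-hand side is the integrand of \<open>integrand_eq\<close> with each
  \<open>1 / u ^ k\<close> replaced by its tangent and the error \<open>e\<close> dropped: the
  constants add up to \<open>\<kappa>s\<close>, the coefficients of \<open>ln u\<close> to
  \<open>S\<close>.\<close>

lemma G_gamma_weight: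
  assumes x: "x \<ge> N / 2"
  defines "u \<equiv> (x - a) / N"
  shows "G * gamma_weight a (N + S) x =
    exp (- a) * (exp (- (x - a)) * (x - a) ^ (m * n)) * exp (- \<kappa>s + S * ln u)"
proof -
  have y: "x - a > 0" using u_ge[OF x] N_pos by auto
  have "S * ln u = S * ln (x - a) - S * ln N"
    using y N_pos by (simp add: u_def ln_div right_diff_distrib)
  then have "exp (- \<kappa>s + S * ln u) = exp (- \<kappa>s) * exp (S * ln (x - a)) * exp (- (S * ln N))"
    by (simp add: exp_add[symmetric])
  moreover have "(x - a) powr (N + S) = (x - a) ^ (m * n) * exp (S * ln (x - a))"
    using y unfolding powr_add N_nat by (simp add: powr_realpow[symmetric] powr_def)
  moreover have "N powr (- S) = exp (- (S * ln N))" using N_pos by (simp add: powr_def)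
  moreover have "exp (- a - \<kappa>s) = exp (- a) * exp (- \<kappa>s)" by (simp add: exp_add[symmetric])
  ultimately show ?thesis
    using y by (simp only: G_def gamma_weight_def if_True less_imp_le mult_ac diff_gt_0_iff_gt)
qed

lemma integrand_le:
  assumes x: "x \<ge> N / 2"
  shows "exp (- x) * poly (touchard_poly m) x ^ n \<le> exp \<rho> * G * gamma_weight a (N + S) x"
proof -
  define u where "u = (x - a) / N"
  have "u \<ge> 1 / 4" using u_ge(1)[OF x] by (simp only: u_def)
  then have u: "u > 0" by simp
  define B where "B = exp (- a) * (exp (- (x - a)) * (x - a) ^ (m * n))"
  have B: "B \<ge> 0" using u_ge[OF x] N_pos by (simp add: B_def)
  obtain e where e: "\<bar>e\<bar> \<le> \<rho>" "exp (- x) * poly (touchard_poly m) x ^ n =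
     B * exp (- (\<kappa> 2 * (1 / u ^ 2)) - \<kappa> 3 * (1 / u ^ 3) - \<kappa> 4 * (1 / u ^ 4) + e)"
    using integrand_eq[OF x] by (auto simp: B_def u_def)
  have "- (\<kappa> 2 * (1 / u ^ 2)) - \<kappa> 3 * (1 / u ^ 3) - \<kappa> 4 * (1 / u ^ 4) + e \<le> \<rho> + (- \<kappa>s + S * ln u)"
    using mult_left_mono[OF inverse_power_ge[OF u, of 2] \<kappa>_nonneg(1)]
      mult_left_mono[OF inverse_power_ge[OF u, of 3] \<kappa>_nonneg(2)]
      mult_left_mono[OF inverse_power_ge[OF u, of 4] \<kappa>_nonneg(3)] e(1)
    by (simp add: \<kappa>s_def S_def algebra_simps)
  then have "exp (- x) * poly (touchard_poly m) x ^ n \<le> B * exp (\<rho> + (- \<kappa>s + S * ln u))"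
    unfolding e(2) using B by (intro mult_left_mono) auto
  also have "\<dots> = exp \<rho> * (B * exp (- \<kappa>s + S * ln u))"
    by (simp only: exp_add mult_ac)
  finally show ?thesis
    using G_gamma_weight[OF x] by (simp only: B_def u_def mult.assoc)
qed

text \<open>The quadratic loss \<open>z\<close> in the exponent is linearised by
  \<open>1 - z \<le> exp (- z)\<close>. As this holds for every \<open>z\<close>, the minorant is
  valid for all \<open>x \<ge> N / 2\<close>, even where it is negative.\<close>

lemma integrand_ge:
  assumes x: "x \<ge> N / 2"
  shows "exp (- x) * poly (touchard_poly m) x ^ n \<ge>
    exp (- \<rho>) * G * (gamma_weight a (N + S) x * (1 - 448 * \<kappa>s * ((x - a) / N - 1) ^ 2))"
proof -
  define u where "u = (x - a) / N"
  have u: "u \<ge> 1 / 4" using u_ge(1)[OF x] by (simp only: u_def)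
  define B where "B = exp (- a) * (exp (- (x - a)) * (x - a) ^ (m * n))"
  have B: "B \<ge> 0" using u_ge[OF x] N_pos by (simp add: B_def)
  obtain e where e: "\<bar>e\<bar> \<le> \<rho>" "exp (- x) * poly (touchard_poly m) x ^ n =
     B * exp (- (\<kappa> 2 * (1 / u ^ 2)) - \<kappa> 3 * (1 / u ^ 3) - \<kappa> 4 * (1 / u ^ 4) + e)"
    using integrand_eq[OF x] by (auto simp: B_def u_def)
  define z where "z = 448 * \<kappa>s * (u - 1) ^ 2"
  have "- \<rho> + (- \<kappa>s + S * ln u) - z \<le> - (\<kappa> 2 * (1 / u ^ 2)) - \<kappa> 3 * (1 / u ^ 3) - \<kappa> 4 * (1 / u ^ 4) + e"
    using mult_left_mono[OF inverse_power_le[OF u, of 2] \<kappa>_nonneg(1)]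
      mult_left_mono[OF inverse_power_le[OF u, of 3] \<kappa>_nonneg(2)]
      mult_left_mono[OF inverse_power_le[OF u, of 4] \<kappa>_nonneg(3)] e(1)
    by (simp add: \<kappa>s_def S_def z_def algebra_simps)
  then have "B * exp (- \<rho> + (- \<kappa>s + S * ln u) - z) \<le> exp (- x) * poly (touchard_poly m) x ^ n"
    unfolding e(2) using B by (intro mult_left_mono) auto
  moreover have "exp (- \<rho> + (- \<kappa>s + S * ln u) - z) = exp (- \<rho>) * exp (- \<kappa>s + S * ln u) * exp (- z)"
    by (simp add: exp_add exp_diff exp_minus field_simps)
  moreover have "1 - z \<le> exp (- z)" using exp_ge_add_one_self[of "- z"] by simp
  then have "(B * (exp (- \<rho>) * exp (- \<kappa>s + S * ln u))) * (1 - z) \<le>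
      (B * (exp (- \<rho>) * exp (- \<kappa>s + S * ln u))) * exp (- z)"
    using B by (intro mult_left_mono) auto
  ultimately have "exp (- \<rho>) * (B * exp (- \<kappa>s + S * ln u)) * (1 - z) \<le>
      exp (- x) * poly (touchard_poly m) x ^ n"
    by (simp add: mult_ac)
  also have "B * exp (- \<kappa>s + S * ln u) = G * gamma_weight a (N + S) x"
    using G_gamma_weight[OF x] by (simp only: B_def u_def)
  finally show ?thesis by (simp only: z_def u_def mult.assoc)
qed

section \<open>Tail of the integral and bounds for the count\<close>

definition T :: real where "T = exp (4 * real m) * exp (- (N / 2)) * (N / 2) ^ (m * n)"

text \<open>Both \<open>x\<close> and the roots lie in \<open>[0, z]\<close> with
  \<open>z = max x (4 * m)\<close>, so every factor is at most \<open>z\<close>. Exchanging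
  \<open>exp (- x)\<close> for \<open>exp (- z)\<close> costs at most \<open>exp (4 * m)\<close>,
  and \<open>exp (- z) * z ^ N\<close> increases up to \<open>N / 2\<close>.\<close>

lemma integrand_tail:
  assumes x: "0 \<le> x" "x \<le> N / 2"
  shows "\<bar>exp (- x) * poly (touchard_poly m) x ^ n\<bar> \<le> T"
proof -
  define z where "z = max x (4 * real m)"
  have z: "z > 0" "z \<le> N / 2" "- x \<le> 4 * real m - z"
    using x m_pos N_ge by (auto simp: z_def)
  have "\<bar>poly (touchard_poly m) x\<bar> = (\<Prod>i<m. \<bar>x - r i\<bar>)"
    by (simp add: r_prod poly_prod abs_prod)
  also have "\<dots> \<le> (\<Prod>i<m. z)"
    using r_bounds x by (intro prod_mono) (force simp: z_def abs_le_iff)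
  finally have "\<bar>poly (touchard_poly m) x\<bar> \<le> z ^ m" by simp
  then have "\<bar>poly (touchard_poly m) x\<bar> ^ n \<le> (z ^ m) ^ n" by (intro power_mono) auto
  then have "\<bar>exp (- x) * poly (touchard_poly m) x ^ n\<bar> \<le> exp (4 * real m - z) * z ^ (m * n)"
    unfolding abs_mult power_abs power_mult using z by (intro mult_mono) auto
  also have "\<dots> = exp (4 * real m) * (exp (- z) * z ^ (m * n))"
    by (simp add: exp_diff exp_minus field_simps)
  also have "\<dots> \<le> exp (4 * real m) * (exp (- (N / 2)) * (N / 2) ^ (m * n))"
  proof (intro mult_left_mono)
    have "ln (z / (N / 2)) \<le> z / (N / 2) - 1" using z N_pos by (intro ln_le_minus_one) simp
    then have "N * ln (z / (N / 2)) \<le> N * (z / (N / 2) - 1)" using N_pos by (intro mult_left_mono) auto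
    also have "\<dots> = 2 * (z - N / 2)" using N_pos by (simp add: field_simps)
    also have "\<dots> \<le> z - N / 2" using z by simp
    finally have "N * ln z - z \<le> N * ln (N / 2) - N / 2"
      using z N_pos by (subst (asm) ln_div) (auto simp: right_diff_distrib)
    moreover have "exp (- w) * w ^ (m * n) = exp (N * ln w - w)" if "w > 0" for w
    proof -
      have "w ^ (m * n) = exp (real (m * n) * ln w)"
        unfolding exp_of_nat_mult using that by simp
      then show ?thesis by (simp only: N_nat exp_diff exp_minus) (simp add: field_simps)
    qed
    ultimately show "exp (- z) * z ^ (m * n) \<le> exp (- (N / 2)) * (N / 2) ^ (m * n)"
      using z N_pos by simp
  qed simp
  finally show ?thesis by (simp add: T_def mult.assoc)
qed

lemma G_pos: "G > 0"
  using N_pos by (simp add: G_def)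

lemma has_integral_tail: "((\<lambda>x. if x \<in> {0..N / 2} then T else 0) has_integral T * (N / 2)) UNIV"
  using has_integral_const_real[of T 0 "N / 2"] N_pos
  by (simp only: has_integral_restrict_UNIV) (simp add: mult.commute)

lemma D_le: "real (D m n) \<le> exp \<rho> * G * Gamma (N + S + 1) + T * (N / 2)"
proof (rule has_integral_le)
  show "((\<lambda>x. if x \<ge> 0 then exp (- x) * poly (touchard_poly m ^ n) x else 0) has_integral real (D m n)) UNIV"
    unfolding D_eq_poly_laplace by (rule has_integral_poly_laplace)
  show "((\<lambda>x. exp \<rho> * G * gamma_weight a (N + S) x + (if x \<in> {0..N / 2} then T else 0))
      has_integral exp \<rho> * G * Gamma (N + S + 1) + T * (N / 2)) UNIV"
    using N_pos S_nonneg
    by (intro has_integral_add has_integral_mult_right has_integral_gamma_weight has_integral_tail) simp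
  fix x :: real
  consider "x < 0" | "0 \<le> x" "x \<le> N / 2" | "x > N / 2" by linarith
  then show "(if x \<ge> 0 then exp (- x) * poly (touchard_poly m ^ n) x else 0) \<le>
      exp \<rho> * G * gamma_weight a (N + S) x + (if x \<in> {0..N / 2} then T else 0)"
  proof cases
    case 2
    then show ?thesis
      using integrand_tail[of x] G_pos gamma_weight_nonneg[of a "N + S" x]
      by (simp add: poly_power abs_le_iff add_increasing)
  next
    case 3
    then show ?thesis using integrand_le[of x] N_pos by (simp add: poly_power)
  qed (use G_pos gamma_weight_nonneg[of a "N + S" x] in simp)
qed

text \<open>The mean of \<open>((x - a) / N - 1) ^ 2\<close> under the normalised Gamma density with
  exponent \<open>N + S\<close>.\<close>

definition V :: real where "V = ((S + 1) ^ 2 + (N + S + 1)) / N ^ 2"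

text \<open>The summand \<open>4\<close> makes the minorant of the integrand nonpositive for \<open>x \<le> N / 2\<close>, where
  \<open>(x - a) / N \<le> 1 / 2\<close>.\<close>

lemma D_ge:
  "real (D m n) \<ge> exp (- \<rho>) * G * (Gamma (N + S + 1) * (1 - (448 * \<kappa>s + 4) * V)) - T * (N / 2)"
proof (rule has_integral_le)
  let ?w = "gamma_weight a (N + S)" and ?v = "\<lambda>x. ((x - a) / N - 1) ^ 2"
  show "((\<lambda>x. if x \<ge> 0 then exp (- x) * poly (touchard_poly m ^ n) x else 0) has_integral real (D m n)) UNIV"
    unfolding D_eq_poly_laplace by (rule has_integral_poly_laplace)
  have "((\<lambda>x. ?w x * ?v x) has_integral Gamma (N + S + 1) * V) UNIV"
    using has_integral_gamma_weight_second_moment[of "N + S" N a] N_pos S_nonneg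
    by (simp add: V_def add.assoc)
  then have "((\<lambda>x. exp (- \<rho>) * G * (?w x - (448 * \<kappa>s + 4) * (?w x * ?v x))
        - (if x \<in> {0..N / 2} then T else 0))
      has_integral exp (- \<rho>) * G * (Gamma (N + S + 1) - (448 * \<kappa>s + 4) * (Gamma (N + S + 1) * V))
        - T * (N / 2)) UNIV"
    using N_pos S_nonneg
    by (intro has_integral_diff has_integral_mult_right has_integral_gamma_weight has_integral_tail) auto
  also have "Gamma (N + S + 1) - (448 * \<kappa>s + 4) * (Gamma (N + S + 1) * V) =
      Gamma (N + S + 1) * (1 - (448 * \<kappa>s + 4) * V)" by (simp add: algebra_simps)
  finally show "((\<lambda>x. exp (- \<rho>) * G * (?w x - (448 * \<kappa>s + 4) * (?w x * ?v x))
        - (if x \<in> {0..N / 2} then T else 0))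
      has_integral exp (- \<rho>) * G * (Gamma (N + S + 1) * (1 - (448 * \<kappa>s + 4) * V)) - T * (N / 2)) UNIV" .
  fix x :: real
  have factor: "?w x - (448 * \<kappa>s + 4) * (?w x * ?v x) = ?w x * (1 - (448 * \<kappa>s + 4) * ?v x)"
    by (simp add: algebra_simps)
  have small: "exp (- \<rho>) * G * (?w x - (448 * \<kappa>s + 4) * (?w x * ?v x)) \<le> 0" if "x \<le> N / 2"
  proof -
    have "(x - a) / N \<le> 1 / 2" using that a_bounds N_pos by (simp add: field_simps)
    then have "(1 / 2) ^ 2 \<le> (1 - (x - a) / N) ^ 2" by (intro power_mono) auto
    then have "1 / 4 \<le> ?v x" by (simp add: power2_commute power_divide)
    moreover have "0 \<le> 448 * \<kappa>s * ?v x" using \<kappa>s_nonneg by simp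
    ultimately have "1 - (448 * \<kappa>s + 4) * ?v x \<le> 0" by (simp add: algebra_simps)
    then show ?thesis
      unfolding factor using G_pos gamma_weight_nonneg[of a "N + S" x]
      by (intro mult_nonneg_nonpos) auto
  qed
  consider "x < 0" | "0 \<le> x" "x \<le> N / 2" | "x > N / 2" by linarith
  then show "exp (- \<rho>) * G * (?w x - (448 * \<kappa>s + 4) * (?w x * ?v x))
        - (if x \<in> {0..N / 2} then T else 0) \<le>
      (if x \<ge> 0 then exp (- x) * poly (touchard_poly m ^ n) x else 0)"
  proof cases
    case 1
    then show ?thesis using small N_pos by simp
  next
    case 2
    then show ?thesis using small integrand_tail[of x] by (simp add: poly_power abs_le_iff)
  next
    case 3
    have "?w x * (1 - (448 * \<kappa>s + 4) * ?v x) \<le> ?w x * (1 - 448 * \<kappa>s * ?v x)"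
      using gamma_weight_nonneg[of a "N + S" x] by (intro mult_left_mono) (auto simp: algebra_simps)
    then have "exp (- \<rho>) * G * (?w x * (1 - (448 * \<kappa>s + 4) * ?v x)) \<le>
        exp (- \<rho>) * G * (?w x * (1 - 448 * \<kappa>s * ?v x))"
      by (rule mult_left_mono) (use G_pos in simp)
    also have "\<dots> \<le> exp (- x) * poly (touchard_poly m) x ^ n" using 3 by (intro integrand_ge) simp
    finally show ?thesis using 3 N_pos unfolding factor by (simp add: poly_power)
  qed
qed

end

section \<open>Error terms\<close>

text \<open>A single term of the exponential series; it takes the place of Stirling's formula in the
  tail bound.\<close>

lemma power_le_fact_mult_exp: "real k ^ k \<le> fact k * exp (real k)"
proof -
  have "(\<Sum>i\<in>{k}. real k ^ i /\<^sub>R fact i) \<le> (\<Sum>i. real k ^ i /\<^sub>R fact i)"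
    by (intro sum_le_suminf summable_exp_generic) auto
  then show ?thesis by (simp add: exp_def field_simps)
qed

definition AO_exponent :: "nat \<Rightarrow> nat \<Rightarrow> real" where
  "AO_exponent m n = - real m / 2 + 1 / 2 - 5 * real m / (24 * real n)
     - real m / (8 * real n ^ 2) - 251 * real m / (2880 * real n ^ 3)"

definition AO_error :: "nat \<Rightarrow> nat \<Rightarrow> real" where
  "AO_error m n = ln (real (D m n) / (fact (m * n) * exp (AO_exponent m n)))"

lemma D_eq_AO_error:
  "real (D m n) = fact (m * n) * exp (AO_exponent m n + AO_error m n)"
  using D_pos[of m n] by (simp add: AO_error_def exp_add)

context touchard_roots
begin

text \<open>The exponent as the integral delivers it: \<open>- a\<close> from the shift,
  \<open>- \<kappa>s\<close> from the tangents at \<open>u = 1\<close>, and the last term from the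
  ratio of Gamma values.\<close>

definition \<Lambda> :: real where "\<Lambda> = - a - \<kappa>s + S ^ 2 / (2 * N)"

lemma G_Gamma:
  "\<exists>\<delta>. - (S ^ 3 / N ^ 2) \<le> \<delta> \<and> \<delta> \<le> S / N \<and>
     G * Gamma (N + S + 1) = fact (m * n) * exp \<Lambda> * exp \<delta>"
proof -
  define \<delta> where "\<delta> = ln_Gamma (N + 1 + S) - ln_Gamma (N + 1) - S * ln N - S ^ 2 / (2 * N)"
  have fact: "exp (ln_Gamma (N + 1)) = fact (m * n)"
    using N_pos Gamma_fact[of "m * n", where 'a = real]
    by (simp add: ln_Gamma_real_pos Gamma_real_pos N_nat add.commute)
  have "Gamma (N + S + 1) = exp (ln_Gamma (N + 1 + S))"
    using N_pos S_nonneg by (simp add: ln_Gamma_real_pos Gamma_real_pos add_ac)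
  moreover have "G = exp (- a - \<kappa>s - S * ln N)"
    using N_pos by (simp add: G_def powr_def exp_add[symmetric])
  ultimately have "G * Gamma (N + S + 1) = exp (ln_Gamma (N + 1) + \<Lambda> + \<delta>)"
    by (simp add: exp_add[symmetric] \<Lambda>_def \<delta>_def)
  then have "G * Gamma (N + S + 1) = fact (m * n) * exp \<Lambda> * exp \<delta>"
    by (simp only: exp_add fact)
  then show ?thesis
    using ln_Gamma_increment[OF N_pos S_nonneg S_le_N] unfolding \<delta>_def[symmetric] by blast
qed

text \<open>By \<open>N ^ N \<le> N! * exp N\<close> the tail is smaller than the main term by a
  factor \<open>exp (- N / 16)\<close>: \<open>ln 2 \<ge> 2 / 3\<close> leaves \<open>N / 6\<close>
  in the exponent, of which \<open>n \<ge> 64\<close> lets \<open>6 * m\<close> use only a part.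
  Here \<open>4 * m\<close> comes from \<open>T\<close> and \<open>2 * m\<close> from
  \<open>\<Lambda> \<ge> - 2 * m\<close>.\<close>

lemma tail_le: "T * (N / 2) \<le> fact (m * n) * exp \<Lambda> * (256 / N)"
proof -
  have "\<kappa>s \<le> 94 * real m / 64"
    by (rule order_trans[OF \<kappa>s_le]) (use n_ge' in \<open>intro divide_left_mono, auto\<close>)
  moreover have "0 \<le> S ^ 2 / (2 * N)" using N_pos by simp
  ultimately have \<Lambda>: "\<Lambda> \<ge> - 2 * real m" using a_bounds by (simp add: \<Lambda>_def)
  have "6 * real m + N / 2 - N * ln 2 \<le> - (N / 16)"
  proof -
    have "N * (2 / 3) \<le> N * ln 2" using N_pos by (intro mult_left_mono ln2_ge_two_thirds) simp
    then show ?thesis using N_ge N_pos by linarith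
  qed
  then have E: "4 * real m - N / 2 - N * ln 2 + N \<le> \<Lambda> - N / 16" using \<Lambda> by simp
  have "(N / 16) ^ 2 / 2 \<le> exp (N / 16)"
    using exp_lower_Taylor_quadratic[of "N / 16"] N_pos by simp
  then have e16: "N * exp (- (N / 16)) \<le> 512 / N"
    using N_pos by (simp add: exp_minus field_simps power2_eq_square)
  have half: "(N / 2) ^ (m * n) = N ^ (m * n) * exp (- (N * ln 2))"
  proof -
    have "exp (N * ln 2) = 2 ^ (m * n)" unfolding N_nat exp_of_nat_mult by simp
    then show ?thesis by (simp add: power_divide exp_minus field_simps)
  qed
  have "T = N ^ (m * n) * exp (4 * real m - N / 2 - N * ln 2)"
    unfolding T_def half by (simp add: exp_add[symmetric] mult_ac)
  also have "\<dots> \<le> (fact (m * n) * exp N) * exp (4 * real m - N / 2 - N * ln 2)"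
    using power_le_fact_mult_exp[of "m * n"] unfolding N_nat by (intro mult_right_mono) auto
  also have "\<dots> = fact (m * n) * exp (4 * real m - N / 2 - N * ln 2 + N)"
    by (simp add: exp_add[symmetric] mult_ac)
  also have "\<dots> \<le> fact (m * n) * exp (\<Lambda> - N / 16)"
    using E by (intro mult_left_mono) auto
  also have "\<dots> = fact (m * n) * exp \<Lambda> * exp (- (N / 16))"
    by (simp add: exp_add[symmetric])
  finally have "T * (N / 2) \<le> fact (m * n) * exp \<Lambda> * exp (- (N / 16)) * (N / 2)"
    using N_pos by (intro mult_right_mono) auto
  also have "\<dots> = fact (m * n) * exp \<Lambda> * (N * exp (- (N / 16)) / 2)" by simp
  also have "\<dots> \<le> fact (m * n) * exp \<Lambda> * (512 / N / 2)"
    using e16 by (intro mult_left_mono divide_right_mono) auto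
  finally show ?thesis by simp
qed

lemma ratio_le:
  "real (D m n) / (fact (m * n) * exp \<Lambda>) \<le> exp (\<rho> + S / N + 256 / N)"
proof -
  let ?F = "fact (m * n) * exp \<Lambda>"
  obtain \<delta> where \<delta>: "\<delta> \<le> S / N" "G * Gamma (N + S + 1) = ?F * exp \<delta>"
    using G_Gamma by blast
  have s: "\<rho> + S / N \<ge> 0" using S_nonneg N_pos n_pos by (simp add: \<rho>_def)
  have "real (D m n) \<le> exp \<rho> * (?F * exp \<delta>) + ?F * (256 / N)"
    using D_le tail_le unfolding mult.assoc[of "exp \<rho>" G] \<delta>(2) by linarith
  also have "\<dots> = ?F * (exp (\<rho> + \<delta>) + 256 / N)" by (simp add: exp_add algebra_simps)
  also have "\<dots> \<le> ?F * (exp (\<rho> + S / N) + exp (\<rho> + S / N) * (256 / N))"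
  proof (intro mult_left_mono add_mono)
    have "1 * (256 / N) \<le> exp (\<rho> + S / N) * (256 / N)"
      using s N_pos by (intro mult_right_mono) auto
    then show "256 / N \<le> exp (\<rho> + S / N) * (256 / N)" by simp
  qed (use \<delta> in auto)
  also have "\<dots> = ?F * (exp (\<rho> + S / N) * (1 + 256 / N))" by (simp add: algebra_simps)
  also have "\<dots> \<le> ?F * (exp (\<rho> + S / N) * exp (256 / N))"
    by (intro mult_left_mono exp_ge_add_one_self) auto
  finally show ?thesis by (simp add: exp_add field_simps)
qed

lemma ratio_ge:
  assumes W: "(448 * \<kappa>s + 4) * V \<le> 1"
  shows "real (D m n) / (fact (m * n) * exp \<Lambda>) \<ge>
           1 - (\<rho> + S ^ 3 / N ^ 2 + (448 * \<kappa>s + 4) * V + 256 / N)"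
proof -
  let ?F = "fact (m * n) * exp \<Lambda>" and ?W = "(448 * \<kappa>s + 4) * V" and ?s = "\<rho> + S ^ 3 / N ^ 2"
  obtain \<delta> where \<delta>: "- (S ^ 3 / N ^ 2) \<le> \<delta>" "G * Gamma (N + S + 1) = ?F * exp \<delta>"
    using G_Gamma by blast
  have s: "?s \<ge> 0" using S_nonneg N_pos n_pos by (simp add: \<rho>_def)
  have W0: "?W \<ge> 0" using \<kappa>s_nonneg S_nonneg N_pos by (simp add: V_def)
  have "1 - (?s + ?W) \<le> (1 - ?s) * (1 - ?W)" using mult_nonneg_nonneg[OF s W0] by (simp add: algebra_simps)
  also have "\<dots> \<le> exp (- ?s) * (1 - ?W)"
  proof (rule mult_right_mono)
    show "1 - ?s \<le> exp (- ?s)" using exp_ge_add_one_self[of "- ?s"] by linarith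
  qed (use W in simp)
  also have "\<dots> \<le> exp (- \<rho> + \<delta>) * (1 - ?W)"
    using W \<delta>(1) by (intro mult_right_mono) auto
  finally have "?F * (1 - (?s + ?W) - 256 / N) \<le> ?F * (exp (- \<rho> + \<delta>) * (1 - ?W) - 256 / N)"
    by (intro mult_left_mono) auto
  also have "\<dots> = exp (- \<rho>) * (?F * exp \<delta>) * (1 - ?W) - ?F * (256 / N)"
    unfolding exp_add by (simp add: algebra_simps)
  also have "\<dots> \<le> real (D m n)"
  proof -
    have "exp (- \<rho>) * G * (Gamma (N + S + 1) * (1 - ?W)) =
        exp (- \<rho>) * (G * Gamma (N + S + 1)) * (1 - ?W)" by (simp only: mult.assoc)
    also have "\<dots> = exp (- \<rho>) * (?F * exp \<delta>) * (1 - ?W)" by (simp only: \<delta>(2))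
    finally show ?thesis using D_ge tail_le by linarith
  qed
  finally show ?thesis by (simp add: field_simps)
qed

section \<open>Error terms measured in units of \<open>C / n\<close>\<close>

context
  fixes C :: real
  assumes C: "C \<ge> 1" and m_le: "real m \<le> C * real n ^ 3"
begin

text \<open>The cubic growth condition enters here.\<close>

lemma m_div_le: "k \<ge> 4 \<Longrightarrow> real m / real n ^ k \<le> C / real n"
proof -
  assume k: "k \<ge> 4"
  have "real m / real n ^ k \<le> real m / real n ^ 4"
    using k n_ge' by (intro divide_left_mono power_increasing) auto
  also have "\<dots> \<le> (C * real n ^ 3) / real n ^ 4"
    using m_le by (intro divide_right_mono) auto
  also have "\<dots> = C / real n" using n_pos by (simp add: field_simps eval_nat_numeral)
  finally show ?thesis .
qed

lemma inverse_n_le: "k \<ge> 1 \<Longrightarrow> 1 / real n ^ k \<le> C / real n"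
  using C n_ge' self_le_power[of "real n" k] by (intro frac_le) auto

lemma inverse_N_le: "1 / N \<le> C / real n"
proof -
  have "1 / N \<le> 1 / real n" using n_pos m_ge' by (intro divide_left_mono) (auto simp: N_def)
  also have "\<dots> \<le> C / real n" using C by (intro divide_right_mono) auto
  finally show ?thesis .
qed

lemma S_div_N_le: "S / N \<le> 338 / real n ^ 2"
proof -
  have "S / N \<le> 338 * real m / real n / N" using S_le N_pos by (intro divide_right_mono) auto
  also have "\<dots> = 338 / real n ^ 2" using m_pos n_pos by (simp add: N_def field_simps power2_eq_square)
  finally show ?thesis .
qed

lemma upper_errors: "\<rho> + S / N + 256 / N \<le> 3000000 * (C / real n)"
proof -
  have "\<rho> = 2097152 * (real m / real n ^ 4)" by (simp add: \<rho>_def)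
  then have "\<rho> \<le> 2097152 * (C / real n)" using m_div_le[of 4] by simp
  moreover have "S / N \<le> 338 * (C / real n)" using S_div_N_le inverse_n_le[of 2] by simp
  moreover have "256 / N \<le> 256 * (C / real n)" using inverse_N_le by simp
  moreover have "0 \<le> C / real n" using C by simp
  ultimately show ?thesis by linarith
qed

text \<open>\<open>V\<close> is of order \<open>1 / N + (S / N) ^ 2\<close> with
  \<open>S / N\<close> of order \<open>1 / n ^ 2\<close>, so the possibly large factor
  \<open>\<kappa>s\<close> of order \<open>m / n\<close> still leaves
  \<open>1 / n ^ 2 + m / n ^ 5\<close>.\<close>

lemma V_le: "(448 * \<kappa>s + 4) * V \<le> 10000000000 * (C / real n)"
proof -
  have SN: "0 \<le> S / N" using S_nonneg N_pos by simp
  have "V \<le> (2 * S ^ 2 + 5 * N) / N ^ 2"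
  proof -
    have "(S + 1) ^ 2 \<le> 2 * S ^ 2 + 2"
      using zero_le_power2[of "S - 1"] by (simp add: power2_eq_square algebra_simps)
    moreover have "N \<ge> 1" using N_ge m_ge' by simp
    ultimately have "(S + 1) ^ 2 + (N + S + 1) \<le> 2 * S ^ 2 + 5 * N" using S_le_N by simp
    then show ?thesis unfolding V_def by (intro divide_right_mono) auto
  qed
  also have "\<dots> = 2 * (S / N) ^ 2 + 5 / N"
    using N_pos by (simp add: field_simps power2_eq_square)
  also have "\<dots> \<le> 2 * (338 / real n ^ 2) ^ 2 + 5 / N"
    using S_div_N_le SN by (intro add_mono mult_left_mono power_mono) auto
  finally have V: "V \<le> 228488 / real n ^ 4 + 5 / N" by (simp add: power_divide power_mult[symmetric])
  have V0: "V \<ge> 0" using S_nonneg N_pos by (simp add: V_def)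
  have "\<kappa>s * V \<le> (94 * real m / real n) * (228488 / real n ^ 4 + 5 / N)"
    using \<kappa>s_le \<kappa>s_nonneg V V0 by (intro mult_mono) auto
  also have "\<dots> = 21477872 * (real m / real n ^ 5) + 470 * (1 / real n ^ 2)"
    using m_pos n_pos by (simp add: N_def field_simps eval_nat_numeral)
  also have "\<dots> \<le> 21477872 * (C / real n) + 470 * (C / real n)"
    using m_div_le[of 5] inverse_n_le[of 2] by (intro add_mono mult_left_mono) auto
  finally have "\<kappa>s * V \<le> 21478342 * (C / real n)" by simp
  moreover have "V \<le> 228493 * (C / real n)"
    using V inverse_n_le[of 4] inverse_N_le by simp
  moreover have "0 \<le> C / real n" using C by simp
  moreover have "(448 * \<kappa>s + 4) * V = 448 * (\<kappa>s * V) + 4 * V" by (simp add: algebra_simps)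
  ultimately show ?thesis by linarith
qed

lemma lower_errors:
  "\<rho> + S ^ 3 / N ^ 2 + (448 * \<kappa>s + 4) * V + 256 / N \<le> 20000000000 * (C / real n)"
proof -
  have "S ^ 3 / N ^ 2 \<le> (338 * real m / real n) ^ 3 / N ^ 2"
    using S_le S_nonneg by (intro divide_right_mono power_mono) auto
  also have "\<dots> = 38614472 * (real m / real n ^ 5)"
    using m_pos n_pos by (simp add: N_def field_simps eval_nat_numeral)
  finally have "S ^ 3 / N ^ 2 \<le> 38614472 * (C / real n)" using m_div_le[of 5] by simp
  moreover have "0 \<le> C / real n" using C by simp
  moreover have "0 \<le> S / N" using S_nonneg N_pos by simp
  ultimately show ?thesis using upper_errors V_le by linarith
qed

lemma exponent_error: "\<bar>\<Lambda> - AO_exponent m n\<bar> \<le> 20000 * (C / real n)"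
proof -
  define x where "x = real m / real n"
  define s0 where "s0 = 5 / 12 * x"
  have Cn: "0 \<le> C / real n" using C by simp
  \<comment> \<open>Writing the lower terms of the power sums in inverse powers of \<open>m\<close>
    bounds them uniformly in \<open>m \<ge> 1\<close>.\<close>
  define i1 i2 i3 where i_defs: "i1 = 1 / real m" "i2 = 1 / real m ^ 2" "i3 = 1 / real m ^ 3"
  have m1: "i1 \<le> 1" "0 \<le> i1" and m2: "i2 \<le> 1" "0 \<le> i2" and m3: "i3 \<le> 1" "0 \<le> i3"
    using m_ge' by (auto simp: i_defs)
  have k2: "\<bar>\<kappa> 2 - 5 * real m / (24 * real n)\<bar> \<le> 1 / real n"
  proof -
    have "\<kappa> 2 - 5 * real m / (24 * real n) = (7 / 24 * i1 - 1 / 2) * (1 / real n)"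
      using m_pos n_pos unfolding \<kappa>_def q_eq N_def i_defs by (simp add: field_simps eval_nat_numeral)
    then have "\<bar>\<kappa> 2 - 5 * real m / (24 * real n)\<bar> = \<bar>7 / 24 * i1 - 1 / 2\<bar> * (1 / real n)"
      by (simp only: abs_mult) simp
    also have "\<dots> \<le> 1 * (1 / real n)" using m1 by (intro mult_right_mono) (auto simp: abs_le_iff)
    finally show ?thesis by simp
  qed
  have k3: "\<bar>\<kappa> 3 - real m / (8 * real n ^ 2)\<bar> \<le> 2 * (1 / real n ^ 2)"
  proof -
    have "\<kappa> 3 - real m / (8 * real n ^ 2) =
        (7 / 8 * i1 - 5 / 12 * i2 - 7 / 12) * (1 / real n ^ 2)"
      using m_pos n_pos unfolding \<kappa>_def q_eq N_def i_defs by (simp add: field_simps eval_nat_numeral)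
    then have "\<bar>\<kappa> 3 - real m / (8 * real n ^ 2)\<bar> =
        \<bar>7 / 8 * i1 - 5 / 12 * i2 - 7 / 12\<bar> * (1 / real n ^ 2)"
      by (simp only: abs_mult) simp
    also have "\<dots> \<le> 2 * (1 / real n ^ 2)" using m1 m2 by (intro mult_right_mono) (auto simp: abs_le_iff)
    finally show ?thesis .
  qed
  have k4: "\<bar>\<kappa> 4 - 167 * real m / (960 * real n ^ 3)\<bar> \<le> 10 * (1 / real n ^ 3)"
  proof -
    have "\<kappa> 4 - 167 * real m / (960 * real n ^ 3) =
        (91 / 32 * i1 - 149 / 48 * i2 + 1183 / 960 * i3 - 55 / 48)
        * (1 / real n ^ 3)"
      using m_pos n_pos unfolding \<kappa>_def q_eq N_def i_defs by (simp add: field_simps eval_nat_numeral)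
    then have "\<bar>\<kappa> 4 - 167 * real m / (960 * real n ^ 3)\<bar> =
        \<bar>91 / 32 * i1 - 149 / 48 * i2 + 1183 / 960 * i3 - 55 / 48\<bar>
        * (1 / real n ^ 3)"
      by (simp only: abs_mult) simp
    also have "\<dots> \<le> 10 * (1 / real n ^ 3)"
      using m1 m2 m3 by (intro mult_right_mono) (auto simp: abs_le_iff)
    finally show ?thesis .
  qed
  have "\<bar>S ^ 2 / (2 * N) - 25 * real m / (288 * real n ^ 3)\<bar> \<le> 340 * (1 / real n ^ 3) + 11900 * (real m / real n ^ 4)"
  proof -
    have "64 * real m / real n ^ 3 \<le> real m / real n ^ 2"
      using n_ge' m_pos by (simp add: field_simps eval_nat_numeral)
    then have "3 * \<kappa> 3 + 4 * \<kappa> 4 \<le> 70 * (real m / real n ^ 2)" using \<kappa>_le(2,3) by simp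
    moreover have "S - s0 = 2 * (\<kappa> 2 - 5 * real m / (24 * real n)) + (3 * \<kappa> 3 + 4 * \<kappa> 4)"
      by (simp add: S_def s0_def x_def)
    ultimately have 1: "\<bar>S - s0\<bar> \<le> 2 / real n + 70 * (real m / real n ^ 2)"
      using k2 \<kappa>_nonneg by (simp add: abs_le_iff)
    have 2: "0 \<le> S + s0" "S + s0 \<le> 340 * (real m / real n)"
      using S_le S_nonneg by (auto simp: s0_def x_def)
    \<comment> \<open>\<open>s0\<close> is the leading part of \<open>2 * \<kappa> 2\<close>, and
      \<open>s0 ^ 2 / (2 * N)\<close> is exactly \<open>25 * m / (288 * n ^ 3)\<close>, so a
      difference of squares factors.\<close>
    have "S ^ 2 / (2 * N) - 25 * real m / (288 * real n ^ 3) = (S - s0) * ((S + s0) / (2 * N))"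
      using m_pos n_pos by (simp add: s0_def x_def N_def field_simps eval_nat_numeral)
    then have "\<bar>S ^ 2 / (2 * N) - 25 * real m / (288 * real n ^ 3)\<bar> = \<bar>S - s0\<bar> * ((S + s0) / (2 * N))"
      using 2(1) N_pos by (simp add: abs_mult)
    also have "\<dots> \<le> (2 / real n + 70 * (real m / real n ^ 2)) * (340 * (real m / real n) / (2 * N))"
      using 1 2 N_pos by (intro mult_mono divide_right_mono) auto
    also have "\<dots> = 340 * (1 / real n ^ 3) + 11900 * (real m / real n ^ 4)"
      using m_pos n_pos by (simp add: N_def field_simps eval_nat_numeral)
    finally show ?thesis .
  qed
  then have s: "\<bar>S ^ 2 / (2 * N) - 25 * real m / (288 * real n ^ 3)\<bar> \<le> 12240 * (C / real n)"
    using inverse_n_le[of 3] m_div_le[of 4] by linarith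
  \<comment> \<open>The constant arises as \<open>167 / 960 - 25 / 288 = 251 / 2880\<close>.\<close>
  have "\<Lambda> - AO_exponent m n = - (\<kappa> 2 - 5 * real m / (24 * real n)) - (\<kappa> 3 - real m / (8 * real n ^ 2))
      - (\<kappa> 4 - 167 * real m / (960 * real n ^ 3)) + (S ^ 2 / (2 * N) - 25 * real m / (288 * real n ^ 3))"
    by (simp add: \<Lambda>_def AO_exponent_def \<kappa>s_def a_def field_simps)
  then show ?thesis
    using k2 k3 k4 s inverse_n_le[of 1] inverse_n_le[of 2] inverse_n_le[of 3] Cn by (simp only: power_one_right) linarith
qed

text \<open>The threshold is twice the constant of \<open>lower_errors\<close>, so that
  \<open>\<sigma> \<le> 1 / 2\<close>, where \<open>ln (1 - \<sigma>) \<ge> - 2 * \<sigma>\<close>.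
  It also supplies the condition of \<open>ratio_ge\<close>.\<close>

lemma AO_error_bound:
  assumes "real n \<ge> 40000000000 * C"
  shows "\<bar>AO_error m n\<bar> \<le> 50000000000 * C / real n"
proof -
  define R where "R = real (D m n) / (fact (m * n) * exp \<Lambda>)"
  have R: "R > 0" using D_pos[of m n] by (simp add: R_def)
  have small: "C / real n \<le> 1 / 40000000000" using assms n_pos by (simp add: field_simps)
  have Cn: "0 \<le> C / real n" using C by simp
  have "real (D m n) / (fact (m * n) * exp (AO_exponent m n)) = R * exp (\<Lambda> - AO_exponent m n)"
    by (simp add: R_def exp_diff)
  then have err: "AO_error m n = ln R + (\<Lambda> - AO_exponent m n)"
    using R by (simp add: AO_error_def ln_mult_pos)
  have "ln R \<le> ln (exp (\<rho> + S / N + 256 / N))"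
    using ratio_le R unfolding R_def by (subst ln_le_cancel_iff) auto
  then have up: "ln R \<le> 3000000 * (C / real n)" using upper_errors by simp
  define \<sigma> where "\<sigma> = 20000000000 * (C / real n)"
  have \<sigma>: "0 \<le> \<sigma>" "\<sigma> \<le> 1 / 2" using small Cn unfolding \<sigma>_def by linarith+
  have "(448 * \<kappa>s + 4) * V \<le> 1" using V_le small by linarith
  then have "1 - \<sigma> \<le> R" using ratio_ge lower_errors unfolding R_def \<sigma>_def by linarith
  then have "ln (1 - \<sigma>) \<le> ln R" using R \<sigma> by (subst ln_le_cancel_iff) auto
  moreover have "- \<sigma> - 2 * \<sigma> ^ 2 \<le> ln (1 - \<sigma>)" using \<sigma> by (rule ln_one_minus_pos_lower_bound)
  moreover have "\<sigma> ^ 2 \<le> \<sigma> * (1 / 2)" unfolding power2_eq_square using \<sigma> by (intro mult_left_mono) auto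
  ultimately have "- 2 * \<sigma> \<le> ln R" by linarith
  then show ?thesis
    unfolding err times_divide_eq_right[symmetric] using up exponent_error Cn by (simp only: \<sigma>_def)
qed

end

end

text \<open>Below the threshold \<open>n0\<close> the growth condition leaves finitely many pairs,
  and the sum of their values \<open>n * \<bar>AO_error m n\<bar>\<close> dominates each of them.
  \<open>C'\<close> provides the assumption \<open>C \<ge> 1\<close> of the estimates.\<close>

theorem AO_error_uniform:
  "\<exists>K. \<forall>m n. n \<ge> 1 \<and> 1 \<le> m \<and> real m \<le> C * real n ^ 3 \<longrightarrow> \<bar>AO_error m n\<bar> \<le> K / real n"
proof -
  define C' where "C' = max C 1"
  define n0 where "n0 = nat \<lceil>40000000000 * C'\<rceil>"
  define P where "P = (SIGMA n:{1..<n0}. {m. 1 \<le> m \<and> real m \<le> C' * real n ^ 3})"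
  define K where "K = 50000000000 * C' + (\<Sum>(n, m)\<in>P. real n * \<bar>AO_error m n\<bar>)"
  have fin: "finite P"
    unfolding P_def
  proof (intro finite_SigmaI)
    fix n
    have "{m. 1 \<le> m \<and> real m \<le> C' * real n ^ 3} \<subseteq> {..nat \<lfloor>C' * real n ^ 3\<rfloor>}"
      by (auto simp: le_nat_floor)
    then show "finite {m. 1 \<le> m \<and> real m \<le> C' * real n ^ 3}" using finite_subset by blast
  qed simp
  have sum0: "0 \<le> (\<Sum>(n, m)\<in>P. real n * \<bar>AO_error m n\<bar>)" by (intro sum_nonneg) auto
  have "\<bar>AO_error m n\<bar> \<le> K / real n" if n: "n \<ge> 1" and m: "1 \<le> m" "real m \<le> C * real n ^ 3" for m n
  proof -
    have "C * real n ^ 3 \<le> C' * real n ^ 3" by (intro mult_right_mono) (auto simp: C'_def)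
    with m have mC: "real m \<le> C' * real n ^ 3" by simp
    have C': "C' \<ge> 1" by (simp add: C'_def)
    show ?thesis
    proof (cases "n < n0")
      case True
      then have "(n, m) \<in> P" using n m mC by (simp add: P_def)
      from member_le_sum[OF this _ fin, of "\<lambda>(n, m). real n * \<bar>AO_error m n\<bar>"]
      have "real n * \<bar>AO_error m n\<bar> \<le> (\<Sum>(n, m)\<in>P. real n * \<bar>AO_error m n\<bar>)" by auto
      then have "real n * \<bar>AO_error m n\<bar> \<le> K" using C' by (simp add: K_def)
      then show ?thesis using n by (simp add: field_simps)
    next
      case False
      then have n0: "real n \<ge> 40000000000 * C'" unfolding n0_def by linarith
      then have "real n \<ge> 64" using C' by linarith
      then have "n \<ge> 64" by simp
      obtain r where "\<And>i. i < m \<Longrightarrow> 0 \<le> r i \<and> r i \<le> 4 * real m" "touchard_poly m = (\<Prod>i<m. [:- r i, 1:])"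
        using touchard_poly_roots_bounded[of m] by blast
      then interpret touchard_roots m n r
        using m \<open>n \<ge> 64\<close> by unfold_locales auto
      have "\<bar>AO_error m n\<bar> \<le> 50000000000 * C' / real n"
        using AO_error_bound[OF C' mC n0] .
      also have "\<dots> \<le> K / real n" using sum0 by (intro divide_right_mono) (auto simp: K_def)
      finally show ?thesis .
    qed
  qed
  then show ?thesis by blast
qed

section \<open>Growth conditions and limits\<close>

lemma bigo_inverse_nI:
  fixes f :: "nat \<Rightarrow> real"
  assumes "\<And>n. n \<ge> 1 \<Longrightarrow> \<bar>f n\<bar> \<le> K / real n"
  shows "f \<in> O(\<lambda>n. 1 / real n)"
  by (rule bigoI[of _ K], rule eventually_mono[OF eventually_ge_at_top[of 1]]) (use assms in auto)

text \<open>The finitely many exceptional values are absorbed by adding their sum to the constant,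
  since the uniform estimate requires its growth bound for the given \<open>n\<close>, not only
  eventually.\<close>

lemma bigo_linear_imp_bound:
  fixes f :: "nat \<Rightarrow> real"
  assumes "f \<in> O(\<lambda>n. real n)"
  shows "\<exists>C \<ge> 0. \<forall>n \<ge> 1. \<bar>f n\<bar> \<le> C * real n"
proof -
  obtain c where c: "c > 0" "eventually (\<lambda>n. \<bar>f n\<bar> \<le> c * real n) sequentially"
    using landau_o.bigE[OF assms] by auto
  then obtain n1 where n1: "\<And>n. n \<ge> n1 \<Longrightarrow> \<bar>f n\<bar> \<le> c * real n"
    by (auto simp: eventually_at_top_linorder)
  define C where "C = c + (\<Sum>n<n1. \<bar>f n\<bar>)"
  have s: "0 \<le> (\<Sum>n<n1. \<bar>f n\<bar>)" by (intro sum_nonneg) auto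
  have "\<bar>f n\<bar> \<le> C * real n" if "n \<ge> 1" for n
  proof (cases "n < n1")
    case True
    then have "\<bar>f n\<bar> \<le> (\<Sum>n<n1. \<bar>f n\<bar>)" by (intro member_le_sum) auto
    also have "\<dots> \<le> C * 1" using c by (simp add: C_def)
    also have "\<dots> \<le> C * real n" using that c s by (intro mult_left_mono) (auto simp: C_def)
    finally show ?thesis .
  next
    case False
    then have "\<bar>f n\<bar> \<le> c * real n" using n1 by simp
    also have "\<dots> \<le> C * real n" using s by (intro mult_right_mono) (auto simp: C_def)
    finally show ?thesis .
  qed
  then show ?thesis using c s by (intro exI[of _ C]) (auto simp: C_def)
qed

lemma tendsto_ratio_imp_bound:
  assumes "(\<lambda>n. real (m n) / real n ^ k) \<longlonglongrightarrow> l"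
  shows "\<exists>C. \<forall>n \<ge> 1. real (m n) \<le> C * real n ^ k"
proof -
  obtain B where B: "\<And>n. norm (real (m n) / real n ^ k) \<le> B"
    using convergent_imp_Bseq[OF convergentI[OF assms]] by (auto simp: Bseq_def)
  have "real (m n) \<le> B * real n ^ k" if "n \<ge> 1" for n
    using B[of n] that by (simp add: field_simps)
  then show ?thesis by blast
qed

lemma AO_error_tendsto_0:
  assumes "\<And>n. n \<ge> 1 \<Longrightarrow> 1 \<le> m n" "\<And>n. n \<ge> 1 \<Longrightarrow> real (m n) \<le> C * real n ^ 3"
  shows "(\<lambda>n. AO_error (m n) n) \<longlonglongrightarrow> 0"
proof -
  obtain K where K: "\<And>m n. n \<ge> 1 \<and> 1 \<le> m \<and> real m \<le> C * real n ^ 3 \<Longrightarrow> \<bar>AO_error m n\<bar> \<le> K / real n"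
    using AO_error_uniform[of C] by blast
  show ?thesis
  proof (rule Lim_null_comparison)
    show "eventually (\<lambda>n. norm (AO_error (m n) n) \<le> K / real n) sequentially"
      using eventually_ge_at_top[of 1] by eventually_elim (use K assms in auto)
    show "(\<lambda>n. K / real n) \<longlonglongrightarrow> 0" by (rule lim_const_over_n)
  qed
qed

theorem theorem8:
  shows "(\<forall>C :: real. \<exists>K :: real. \<forall>m :: nat \<Rightarrow> nat. \<forall>n :: nat.
            n \<ge> 1 \<and> 1 \<le> m n \<and> real (m n) \<le> C * real n ^ 3 \<longrightarrow>
            (\<exists>err :: real. \<bar>err\<bar> \<le> K / real n \<and>
               real (D (m n) n) = fact (m n * n) *
                 exp (- real (m n) / 2 + 1 / 2 - 5 * real (m n) / (24 * real n)
                      - real (m n) / (8 * real n ^ 2)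
                      - 251 * real (m n) / (2880 * real n ^ 3) + err)))
       \<and> (\<forall>m :: nat \<Rightarrow> nat.
            (\<forall>n \<ge> 1. 1 \<le> m n) \<and> (\<lambda>n. real (m n)) \<in> O(\<lambda>n. real n) \<longrightarrow>
            (\<lambda>n. real (m n) / (8 * real n ^ 2)) \<in> O(\<lambda>n. 1 / real n) \<and>
            (\<lambda>n. 251 * real (m n) / (2880 * real n ^ 3)) \<in> O(\<lambda>n. 1 / real n) \<and>
            (\<exists>err :: nat \<Rightarrow> real. err \<in> O(\<lambda>n. 1 / real n) \<and>
               (\<forall>n \<ge> 1. real (D (m n) n) = fact (m n * n) *
                  exp (- real (m n) / 2 + 1 / 2 - 5 * real (m n) / (24 * real n) + err n))))
       \<and> (\<forall>(m :: nat \<Rightarrow> nat) (\<rho> :: real).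
            (\<forall>n \<ge> 1. 1 \<le> m n) \<and> (\<lambda>n. real (m n) / real n ^ 2) \<longlonglongrightarrow> \<rho> \<longrightarrow>
            (\<lambda>n. exp (- real (m n) / (8 * real n ^ 2))) \<longlonglongrightarrow> exp (- \<rho> / 8) \<and>
            (\<lambda>n. real (D (m n) n) / (fact (m n * n) *
                  exp (- real (m n) / 2 + 1 / 2 - 5 * real (m n) / (24 * real n))))
              \<longlonglongrightarrow> exp (- \<rho> / 8))
       \<and> (\<forall>(m :: nat \<Rightarrow> nat) (\<sigma> :: real).
            (\<forall>n \<ge> 1. 1 \<le> m n) \<and> (\<lambda>n. real (m n) / real n ^ 3) \<longlonglongrightarrow> \<sigma> \<longrightarrow>
            (\<lambda>n. exp (- 251 * real (m n) / (2880 * real n ^ 3))) \<longlonglongrightarrow> exp (- 251 * \<sigma> / 2880) \<and>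
            (\<lambda>n. real (D (m n) n) / (fact (m n * n) *
                  exp (- real (m n) / 2 + 1 / 2 - 5 * real (m n) / (24 * real n)
                       - real (m n) / (8 * real n ^ 2))))
              \<longlonglongrightarrow> exp (- 251 * \<sigma> / 2880))
       \<and> (\<exists>err :: nat \<Rightarrow> real. err \<in> O(\<lambda>n. 1 / real n) \<and>
            (\<forall>n \<ge> 1. real (num_acyclic_orientations (complete_multipartite n (\<lambda>_. n))) =
               fact (n ^ 2) * exp (- real n / 2 + 7 / 24 + err n)))"
    (is "?uniform \<and> ?linear \<and> ?quadratic \<and> ?cubic \<and> ?diagonal")
proof (intro conjI)
  show ?uniform
  proof
    fix C :: real
    obtain K where "\<And>m n. n \<ge> 1 \<and> 1 \<le> m \<and> real m \<le> C * real n ^ 3 \<Longrightarrow> \<bar>AO_error m n\<bar> \<le> K / real n"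
      using AO_error_uniform[of C] by blast
    then show "\<exists>K :: real. \<forall>m :: nat \<Rightarrow> nat. \<forall>n :: nat.
            n \<ge> 1 \<and> 1 \<le> m n \<and> real (m n) \<le> C * real n ^ 3 \<longrightarrow>
            (\<exists>err :: real. \<bar>err\<bar> \<le> K / real n \<and>
               real (D (m n) n) = fact (m n * n) *
                 exp (- real (m n) / 2 + 1 / 2 - 5 * real (m n) / (24 * real n)
                      - real (m n) / (8 * real n ^ 2)
                      - 251 * real (m n) / (2880 * real n ^ 3) + err))"
      using D_eq_AO_error[unfolded AO_exponent_def] by (intro exI[of _ K]) blast
  qed
  show linear: ?linear
  proof (intro allI impI, elim conjE)
    fix m :: "nat \<Rightarrow> nat"
    assume m1: "\<forall>n \<ge> 1. 1 \<le> m n" and O: "(\<lambda>n. real (m n)) \<in> O(\<lambda>n. real n)"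
    obtain C where C: "C \<ge> 0" "\<And>n. n \<ge> 1 \<Longrightarrow> real (m n) \<le> C * real n"
      using bigo_linear_imp_bound[OF O] by auto
    have div: "real (m n) / real n ^ k \<le> C / real n" if "n \<ge> 1" "k \<ge> 2" for n k
    proof -
      have "real (m n) / real n ^ k \<le> C * real n / real n ^ k"
        using C(2)[OF that(1)] by (intro divide_right_mono) auto
      also have "\<dots> \<le> C * real n / real n ^ 2"
        using that C by (intro divide_left_mono power_increasing) auto
      finally show ?thesis using that by (simp add: power2_eq_square)
    qed
    have b1: "\<bar>real (m n) / (8 * real n ^ 2)\<bar> \<le> C / real n" if "n \<ge> 1" for n
    proof -
      have "\<bar>real (m n) / (8 * real n ^ 2)\<bar> = 1 / 8 * (real (m n) / real n ^ 2)" by simp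
      also have "\<dots> \<le> 1 * (C / real n)" by (rule mult_mono) (use div[OF that, of 2] C in auto)
      finally show ?thesis by simp
    qed
    have b2: "\<bar>251 * real (m n) / (2880 * real n ^ 3)\<bar> \<le> C / real n" if "n \<ge> 1" for n
    proof -
      have "\<bar>251 * real (m n) / (2880 * real n ^ 3)\<bar> = 251 / 2880 * (real (m n) / real n ^ 3)" by simp
      also have "\<dots> \<le> 1 * (C / real n)" by (rule mult_mono) (use div[OF that, of 3] C in auto)
      finally show ?thesis by simp
    qed
    have cubic: "real (m n) \<le> C * real n ^ 3" if "n \<ge> 1" for n
    proof -
      have "C * real n \<le> C * real n ^ 3" using C that by (intro mult_left_mono self_le_power) auto
      then show ?thesis using C(2)[OF that] by simp
    qed
    obtain K where K: "\<And>m n. n \<ge> 1 \<and> 1 \<le> m \<and> real m \<le> C * real n ^ 3 \<Longrightarrow> \<bar>AO_error m n\<bar> \<le> K / real n"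
      using AO_error_uniform[of C] by blast
    \<comment> \<open>For linear \<open>m\<close> the last two terms are themselves
      \<open>O(1 / n)\<close> and join the error.\<close>
    define err where "err = (\<lambda>n. AO_error (m n) n - real (m n) / (8 * real n ^ 2)
      - 251 * real (m n) / (2880 * real n ^ 3))"
    have "\<bar>err n\<bar> \<le> (K + 2 * C) / real n" if "n \<ge> 1" for n
    proof -
      have "\<bar>AO_error (m n) n\<bar> \<le> K / real n" using K m1 cubic that by blast
      moreover have "(K + 2 * C) / real n = K / real n + C / real n + C / real n"
        by (simp add: add_divide_distrib)
      ultimately show ?thesis using b1[OF that] b2[OF that] unfolding err_def by linarith
    qed
    then have "err \<in> O(\<lambda>n. 1 / real n)" by (rule bigo_inverse_nI)
    moreover have "real (D (m n) n) = fact (m n * n) *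
        exp (- real (m n) / 2 + 1 / 2 - 5 * real (m n) / (24 * real n) + err n)" for n
      unfolding D_eq_AO_error by (simp add: AO_exponent_def err_def algebra_simps)
    ultimately show "(\<lambda>n. real (m n) / (8 * real n ^ 2)) \<in> O(\<lambda>n. 1 / real n) \<and>
            (\<lambda>n. 251 * real (m n) / (2880 * real n ^ 3)) \<in> O(\<lambda>n. 1 / real n) \<and>
            (\<exists>err :: nat \<Rightarrow> real. err \<in> O(\<lambda>n. 1 / real n) \<and>
               (\<forall>n \<ge> 1. real (D (m n) n) = fact (m n * n) *
                  exp (- real (m n) / 2 + 1 / 2 - 5 * real (m n) / (24 * real n) + err n)))"
      using bigo_inverse_nI[OF b1] bigo_inverse_nI[OF b2] by blast
  qed
  show ?quadratic
  proof (intro allI impI, elim conjE)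
    fix m :: "nat \<Rightarrow> nat" and \<rho> :: real
    assume m1: "\<forall>n \<ge> 1. 1 \<le> m n" and lim: "(\<lambda>n. real (m n) / real n ^ 2) \<longlonglongrightarrow> \<rho>"
    obtain B where B: "\<And>n. n \<ge> 1 \<Longrightarrow> real (m n) \<le> B * real n ^ 2"
      using tendsto_ratio_imp_bound[OF lim] by blast
    \<comment> \<open>No sign of \<open>B\<close> is recorded, and passing from \<open>n ^ 2\<close>
      to \<open>n ^ 3\<close> requires a nonnegative factor.\<close>
    have "real (m n) \<le> max B 0 * real n ^ 3" if "n \<ge> 1" for n
    proof -
      have "B * real n ^ 2 \<le> max B 0 * real n ^ 3"
        using that by (intro mult_mono power_increasing) auto
      then show ?thesis using B[OF that] by simp
    qed
    then have err: "(\<lambda>n. AO_error (m n) n) \<longlonglongrightarrow> 0" using m1 by (intro AO_error_tendsto_0) auto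
    have lim8: "(\<lambda>n. - (real (m n) / real n ^ 2) / 8) \<longlonglongrightarrow> - \<rho> / 8" by (intro tendsto_intros lim) simp
    \<comment> \<open>The quartic-order term is written as \<open>m / n ^ 2\<close> times
      \<open>1 / n\<close>, so it tends to \<open>\<rho> * 0\<close>.\<close>
    have "(\<lambda>n. exp (- (real (m n) / real n ^ 2) / 8 - 251 / 2880 * (real (m n) / real n ^ 2 * (1 / real n))
        + AO_error (m n) n)) \<longlonglongrightarrow> exp (- \<rho> / 8 - 251 / 2880 * (\<rho> * 0) + 0)"
      by (intro tendsto_intros lim8 lim err lim_const_over_n)
    moreover have "eventually (\<lambda>n. exp (- (real (m n) / real n ^ 2) / 8
        - 251 / 2880 * (real (m n) / real n ^ 2 * (1 / real n)) + AO_error (m n) n) =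
        real (D (m n) n) / (fact (m n * n) *
          exp (- real (m n) / 2 + 1 / 2 - 5 * real (m n) / (24 * real n)))) sequentially"
      unfolding D_eq_AO_error
      by (intro always_eventually allI)
         (simp add: AO_exponent_def exp_diff[symmetric] exp_add[symmetric] power3_eq_cube power2_eq_square)
    ultimately show "(\<lambda>n. exp (- real (m n) / (8 * real n ^ 2))) \<longlonglongrightarrow> exp (- \<rho> / 8) \<and>
            (\<lambda>n. real (D (m n) n) / (fact (m n * n) *
                  exp (- real (m n) / 2 + 1 / 2 - 5 * real (m n) / (24 * real n))))
              \<longlonglongrightarrow> exp (- \<rho> / 8)"
      using tendsto_exp[OF lim8] by (auto simp: mult.commute dest: Lim_transform_eventually)
  qed
  show ?cubic
  proof (intro allI impI, elim conjE)
    fix m :: "nat \<Rightarrow> nat" and \<sigma> :: real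
    assume m1: "\<forall>n \<ge> 1. 1 \<le> m n" and lim: "(\<lambda>n. real (m n) / real n ^ 3) \<longlonglongrightarrow> \<sigma>"
    obtain B where "\<And>n. n \<ge> 1 \<Longrightarrow> real (m n) \<le> B * real n ^ 3"
      using tendsto_ratio_imp_bound[OF lim] by blast
    then have err: "(\<lambda>n. AO_error (m n) n) \<longlonglongrightarrow> 0" using m1 by (intro AO_error_tendsto_0) auto
    have lim': "(\<lambda>n. - 251 * (real (m n) / real n ^ 3) / 2880) \<longlonglongrightarrow> - 251 * \<sigma> / 2880"
      by (intro tendsto_intros lim) simp
    have "(\<lambda>n. exp (- 251 * (real (m n) / real n ^ 3) / 2880 + AO_error (m n) n))
        \<longlonglongrightarrow> exp (- 251 * \<sigma> / 2880 + 0)"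
      by (intro tendsto_intros lim' err)
    moreover have "eventually (\<lambda>n. exp (- 251 * (real (m n) / real n ^ 3) / 2880 + AO_error (m n) n) =
        real (D (m n) n) / (fact (m n * n) *
          exp (- real (m n) / 2 + 1 / 2 - 5 * real (m n) / (24 * real n)
               - real (m n) / (8 * real n ^ 2)))) sequentially"
      unfolding D_eq_AO_error
      by (intro always_eventually allI)
         (simp add: AO_exponent_def exp_diff[symmetric] exp_add[symmetric])
    ultimately show "(\<lambda>n. exp (- 251 * real (m n) / (2880 * real n ^ 3))) \<longlonglongrightarrow> exp (- 251 * \<sigma> / 2880) \<and>
            (\<lambda>n. real (D (m n) n) / (fact (m n * n) *
                  exp (- real (m n) / 2 + 1 / 2 - 5 * real (m n) / (24 * real n)
                       - real (m n) / (8 * real n ^ 2))))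
              \<longlonglongrightarrow> exp (- 251 * \<sigma> / 2880)"
      using tendsto_exp[OF lim'] by (auto simp: mult.commute dest: Lim_transform_eventually)
  qed
  show ?diagonal
  proof -
    \<comment> \<open>The diagonal is the linear case \<open>m = n\<close>, with constant
      \<open>1 / 2 - 5 / 24 = 7 / 24\<close>.\<close>
    have "(\<lambda>n. real n) \<in> O(\<lambda>n. real n)" by simp
    then obtain err where err: "err \<in> O(\<lambda>n. 1 / real n)"
      "\<And>n. n \<ge> 1 \<Longrightarrow> real (D n n) = fact (n * n) * exp (- real n / 2 + 1 / 2 - 5 * real n / (24 * real n) + err n)"
      using linear[rule_format, of "\<lambda>n. n"] by auto
    have "real (num_acyclic_orientations (complete_multipartite n (\<lambda>_. n))) =
               fact (n ^ 2) * exp (- real n / 2 + 7 / 24 + err n)" if "n \<ge> 1" for n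
      using err(2)[OF that] that by (simp add: D_def power2_eq_square)
    then show ?thesis using err(1) by blast
  qed
qed

end
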